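(* There exists $a\in[0,0.4076)$ such that for all $c\in(1,2)$ and all $\eta\in\left(0,\frac{2-(a+1)c}{3-a}\right)$ there is a constant $C=C(c,\eta)$ such that for all $N\geq 2$, \[ \frac 1N\left|\sum_{1\leq n\leq N}(-1)^{s_2(\lfloor n^c\rfloor)}\right|\leq C N^{-\eta}. \] In particular, for every $c$ with $1<c\leq 1.42$ there exist $\eta>\max\{0,(7-5c)/9\}$ and $C$ such that this estimate holds for all $N\geq 2$.
   Context: $s_2(n)$ denotes the sum of the binary digits of the nonnegative integer $n$ (so $(-1)^{s_2(n)}$ is the Thue–Morse sequence); $\lfloor\cdot\rfloor$ is the floor function. *)

theory Defs
  imports Complex_Main
begin

fun s2 :: "nat \<Rightarrow> nat" where
  "s2 n = (if n = 0 then 0 else n mod 2 + s2 (n div 2))"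

declare s2.simps [simp del]

definition tm_ps_sum :: "real \<Rightarrow> nat \<Rightarrow> real" where
  "tm_ps_sum c N = (\<Sum>n = 1..N. (-1::real) ^ s2 (nat \<lfloor>(real n) powr c\<rfloor>))"

end

theory Submission
  imports Defs "HOL-Analysis.Analysis"
begin

text \<open>
  On a window of length \<open>K\<close> the sequence \<open>n powr c\<close> is replaced by its tangent \<open>\<alpha> n + y\<close> at a
  point \<open>x\<close> near the window. The error is of size \<open>\<delta> = K\<^sup>2 N powr (c - 2)\<close>, so the integer part
  changes only when \<open>\<alpha> n + y\<close> is within \<open>\<delta>\<close> of an integer. Detecting membership in the Beatty
  sequence \<open>\<lfloor>\<alpha> n + y\<rfloor>\<close> by a Fejer-smoothed sawtooth bounds the window sum by the values at
  \<open>\<theta> = h / \<alpha>\<close> of a 1-periodic majorant \<open>\<Phi>\<close> of the exponential sums of the Thue--Morse sequence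
  over intervals of length about \<open>K N powr (c - 1)\<close>; the offset \<open>y\<close> has disappeared.

  The window sum does not depend on \<open>x\<close>, so this bound may be integrated over \<open>x\<close>. As \<open>x\<close> runs through
  \<open>[N, 2 N]\<close>, the frequency \<open>h / \<alpha>\<close> sweeps out intervals with controlled speed, which turns the
  average into the integral of \<open>\<Phi>\<close> over a period; this is at most a constant times
  \<open>(K N powr (c - 1)) powr a\<close> with \<open>2 powr a \<ge> 53/40\<close>, for instance \<open>a = 11/27\<close>. The same averaging
  bounds the number of exceptional \<open>n\<close>. Balancing \<open>K powr (a - 1) N powr (a (c - 1))\<close> against \<open>\<delta>\<close>
  gives the exponent \<open>(2 - (a + 1) c) / (3 - a)\<close>.
\<close>

section \<open>The exponential sum of the Thue--Morse sequence\<close>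

definition tm :: "nat \<Rightarrow> real" where
  "tm n = (-1) ^ s2 n"

lemma abs_tm [simp]: "\<bar>tm n\<bar> = 1"
  by (simp add: tm_def power_abs)

lemma tm_double [simp]: "tm (2 * n) = tm n"
  by (cases "n = 0") (simp_all add: tm_def s2.simps[of "2 * n"])

lemma tm_double_Suc [simp]: "tm (Suc (2 * n)) = - tm n"
  by (simp add: tm_def s2.simps[of "Suc (2 * n)"])

text \<open>The factor \<open>2 * \<bar>sin (pi * \<theta>)\<bar>\<close> is the modulus of
  \<open>1 - cis (2 * pi * \<theta>)\<close>, which comes out when the indices \<open>2 * m\<close>
  and \<open>2 * m + 1\<close> are paired. The summand 2 pays for one unpaired index at each end of
  the interval. At level 0 the interval has at most one index; starting from 2 makes the value at 0
  equal to 2 for every \<open>k\<close>.\<close>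

fun tm_major :: "nat \<Rightarrow> real \<Rightarrow> real" where
  "tm_major 0 \<theta> = 2"
| "tm_major (Suc k) \<theta> = 2 + 2 * \<bar>sin (pi * \<theta>)\<bar> * tm_major k (2 * \<theta>)"

lemma tm_major_nonneg: "0 \<le> tm_major k \<theta>"
  by (induction k arbitrary: \<theta>) auto

lemma tm_major_0 [simp]: "tm_major k 0 = 2"
  by (cases k) auto

lemma tm_major_minus [simp]: "tm_major k (- \<theta>) = tm_major k \<theta>"
  by (induction k arbitrary: \<theta>) auto

lemma tm_major_plus_1: "tm_major k (\<theta> + 1) = tm_major k \<theta>"
proof (induction k arbitrary: \<theta>)
  case (Suc k)
  have "tm_major k (2 * (\<theta> + 1)) = tm_major k (2 * \<theta>)"
    using Suc[of "2 * \<theta> + 1"] Suc[of "2 * \<theta>"] by (simp add: algebra_simps)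
  moreover have "\<bar>sin (pi * (\<theta> + 1))\<bar> = \<bar>sin (pi * \<theta>)\<bar>"
    by (simp add: distrib_left)
  ultimately show ?case by simp
qed auto

lemma continuous_on_tm_major [continuous_intros]:
  fixes f :: "real \<Rightarrow> real"
  assumes "continuous_on S f"
  shows "continuous_on S (\<lambda>x. tm_major k (f x))"
  using assms
proof (induction k arbitrary: f)
  case (Suc k)
  have "continuous_on S (\<lambda>x. tm_major k (2 * f x))"
    by (intro Suc.IH continuous_intros Suc.prems)
  then show ?case
    unfolding tm_major.simps by (intro continuous_intros Suc.prems)
qed simp

lemma norm_cis_minus_1: "cmod (1 - cis (2 * pi * \<theta>)) = 2 * \<bar>sin (pi * \<theta>)\<bar>"
proof -
  have "cmod (1 - cis (2 * pi * \<theta>)) = cmod (exp (\<i> * of_real (2 * pi * \<theta>)) - 1)"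
    by (metis cis_conv_exp norm_minus_commute)
  also have "\<dots> = 2 * \<bar>sin (2 * pi * \<theta> / 2)\<bar>"
    by (rule dist_exp_i_1)
  finally show ?thesis by simp
qed

text \<open>The terms at \<open>2 * m\<close> and \<open>2 * m + 1\<close> carry opposite signs, so
  each pair contributes the common factor \<open>1 - cis (2 * pi * \<theta>)\<close> and leaves a
  sum of half the length at the doubled frequency.\<close>

lemma sum_tm_cis_double:
  "(\<Sum>m = 2 * u..<2 * v. of_real (tm m) * cis (2 * pi * real m * \<theta>)) =
   (1 - cis (2 * pi * \<theta>)) * (\<Sum>m = u..<v. of_real (tm m) * cis (2 * pi * real m * (2 * \<theta>)))"
proof (cases "u \<le> v")
  case True
  then show ?thesis
  proof (induction v rule: dec_induct)
    case (step v)
    let ?f = "\<lambda>m. of_real (tm m) * cis (2 * pi * real m * \<theta>)"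
    let ?z = "cis (2 * pi * real v * (2 * \<theta>))"
    have 1: "cis (2 * pi * real (Suc (2 * v)) * \<theta>) = cis (2 * pi * \<theta>) * ?z"
      by (simp add: cis_mult algebra_simps)
    have 2: "cis (2 * pi * real (2 * v) * \<theta>) = ?z"
      by (simp add: algebra_simps)
    have "sum ?f {2 * u..<2 * Suc v} = sum ?f {2 * u..<2 * v} + (?f (2 * v) + ?f (Suc (2 * v)))"
      using step by simp
    also have "?f (2 * v) + ?f (Suc (2 * v)) = (1 - cis (2 * pi * \<theta>)) * (of_real (tm v) * ?z)"
      unfolding 1 2 tm_double tm_double_Suc by (simp add: algebra_simps)
    finally show ?case
      unfolding step.IH using step.hyps by (simp add: distrib_left add.assoc)
  qed auto
qed auto

text \<open>The bound depends on the length of the interval and not on its position; this later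
  removes the offset of the Beatty sequence. In the induction the endpoints are rounded inwards to
  the even numbers \<open>2 * ue\<close> and \<open>2 * ve\<close>, which loses at most one term on
  each side; the rest is halved. If \<open>ue > ve\<close>, the interval is empty.\<close>

lemma norm_tm_exp_sum_le:
  assumes "v \<le> u + 2 ^ k"
  shows "cmod (\<Sum>m = u ..< v. of_real (tm m) * cis (2 * pi * real m * \<theta>)) \<le> tm_major k \<theta>"
  using assms
proof (induction k arbitrary: u v \<theta>)
  case 0
  define f where "f m = of_real (tm m) * cis (2 * pi * real m * \<theta>)" for m
  have "cmod (sum f {u..<v}) \<le> (\<Sum>m = u ..< v. 1)"
    by (rule order_trans[OF norm_sum]) (simp add: f_def norm_mult)
  also have "\<dots> \<le> 2" using 0 by simp
  finally show ?case by (simp add: f_def)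
next
  case (Suc k)
  define f where "f m = of_real (tm m) * cis (2 * pi * real m * \<theta>)" for m
  define ue where "ue = (u + 1) div 2"
  define ve where "ve = v div 2"
  have nf: "cmod (sum f A) \<le> real (card A)" for A
    by (rule order_trans[OF norm_sum]) (simp add: f_def norm_mult)
  show ?case
  proof (cases "ue \<le> ve")
    case True
    have "u \<le> 2 * ue" "2 * ue \<le> 2 * ve" "2 * ve \<le> v"
      using True by (auto simp: ue_def ve_def)
    then have "sum f {u..<v} = sum f {u ..< 2 * ue} + sum f {2 * ue ..< 2 * ve} + sum f {2 * ve ..< v}"
      by (simp add: sum.atLeastLessThan_concat)
    then have "cmod (sum f {u..<v}) \<le>
        cmod (sum f {u ..< 2 * ue}) + cmod (sum f {2 * ue ..< 2 * ve}) + cmod (sum f {2 * ve ..< v})"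
      by (metis (no_types, lifting) add_mono_thms_linordered_semiring(3) norm_triangle_ineq order_trans)
    moreover have "cmod (sum f {u ..< 2 * ue}) \<le> 1"
      using nf[of "{u ..< 2 * ue}"] by (rule order_trans) (auto simp: ue_def)
    moreover have "cmod (sum f {2 * ve ..< v}) \<le> 1"
      using nf[of "{2 * ve ..< v}"] by (rule order_trans) (auto simp: ve_def)
    moreover have "cmod (sum f {2 * ue ..< 2 * ve}) \<le> 2 * \<bar>sin (pi * \<theta>)\<bar> * tm_major k (2 * \<theta>)"
    proof -
      have "ve \<le> ue + 2 ^ k" using Suc.prems by (auto simp: ue_def ve_def)
      from Suc.IH[OF this, of "2 * \<theta>"] show ?thesis
        unfolding f_def sum_tm_cis_double norm_mult norm_cis_minus_1
        by (intro mult_left_mono) auto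
    qed
    ultimately show ?thesis by (simp add: f_def)
  next
    case False
    then have "v \<le> u" by (auto simp: ue_def ve_def)
    then show ?thesis using tm_major_nonneg[of "Suc k" \<theta>] by simp
  qed
qed

text \<open>Integrating out the first factor of the majorant leads to the transfer operator
  \<open>L f \<theta> = sin (\<pi> \<theta>/2) f (\<theta>/2) + cos (\<pi> \<theta>/2) f ((\<theta> + 1)/2)\<close> on \<open>[0,1]\<close>. The weight
  \<open>f \<theta> = 1 + 57/200 \<bar>sin (\<pi> \<theta>)\<bar>\<close> satisfies \<open>L f \<le> 53/40 f\<close>, which in terms of
  \<open>sin (\<pi> \<theta>/2) + cos (\<pi> \<theta>/2)\<close> is a quadratic inequality with negative discriminant.\<close>

definition tm_weight :: "real \<Rightarrow> real" where
  "tm_weight \<theta> = 1 + 57/200 * \<bar>sin (pi * \<theta>)\<bar>"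

lemma continuous_on_tm_weight [continuous_intros]:
  fixes f :: "real \<Rightarrow> real"
  shows "continuous_on S f \<Longrightarrow> continuous_on S (\<lambda>x. tm_weight (f x))"
  unfolding tm_weight_def by (intro continuous_intros)

lemma tm_weight_transfer:
  assumes "0 \<le> \<theta>" "\<theta> \<le> 1"
  shows "\<bar>sin (pi * (\<theta> / 2))\<bar> * tm_weight (\<theta> / 2) +
         \<bar>sin (pi * ((\<theta> + 1) / 2))\<bar> * tm_weight ((\<theta> + 1) / 2) \<le> 53/40 * tm_weight \<theta>"
proof -
  define s where "s = sin (pi * (\<theta> / 2))"
  define c where "c = cos (pi * (\<theta> / 2))"
  have s: "s \<ge> 0" unfolding s_def
    using assms by (intro sin_ge_zero) auto
  have c: "c \<ge> 0" unfolding c_def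
    using assms by (intro cos_ge_zero) (auto intro: order_trans[of _ 0])
  have sc: "s^2 + c^2 = 1" by (simp add: s_def c_def)
  have 1: "sin (pi * ((\<theta> + 1) / 2)) = c"
    by (simp add: c_def distrib_left add_divide_distrib sin_add)
  have 2: "sin (pi * \<theta>) = 2 * s * c"
    using sin_double[of "pi * (\<theta> / 2)"] by (simp add: s_def c_def)
  define u where "u = s + c"
  have u2: "2 * s * c = u^2 - 1" using sc by (simp add: u_def power2_eq_square algebra_simps)
  \<comment> \<open>Multiplied by 8000, the inequality aimed at reads
    \<open>8000 * u \<le> 3021 * u^2 + 5299\<close>, where 3021 = 53 * 57. Completing the square
    gives the smaller constant 16000000/3021 < 5299.\<close>
  have "0 \<le> (3021 * u - 4000)^2" by simp
  also have "\<dots> = 3021 * (3021 * u^2 - 8000 * u) + 16000000"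
    by (simp add: power2_eq_square algebra_simps)
  finally have "8000 * u \<le> 3021 * u^2 + 5299" by simp
  then have "u + 57/200 \<le> 53/40 * (1 + 57/200 * (u^2 - 1))"
    by (simp add: field_simps)
  then have "s + c + 57/200 * (s^2 + c^2) \<le> 53/40 * (1 + 57/200 * (2 * s * c))"
    unfolding u2 sc by (simp add: u_def)
  then show ?thesis
    unfolding tm_weight_def 1 2 s_def[symmetric] using s c
    by (simp add: abs_mult power2_eq_square algebra_simps add_divide_distrib)
qed

text \<open>The interval is cut at 1/2 and each half is stretched to \<open>{0..1}\<close>; by
  periodicity both halves then carry the same factor \<open>p x\<close>. For \<open>q\<close> equal
  to \<open>2 * \<bar>sin (pi * x)\<bar>\<close> times a weight, the mean over the two preimages is
  the transfer operator applied to the weight.\<close>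

lemma integral_mult_double:
  fixes p q :: "real \<Rightarrow> real"
  assumes "continuous_on UNIV p" "continuous_on UNIV q" and per: "\<And>x. p (x + 1) = p x"
  shows "integral {0..1} (\<lambda>x. q x * p (2 * x)) =
         integral {0..1} (\<lambda>x. (q (x / 2) + q ((x + 1) / 2)) / 2 * p x)"
proof -
  define f where "f x = q x * p (2 * x)" for x
  have cp: "continuous_on S (\<lambda>x. p (g x))" if "continuous_on S g" for S and g :: "real \<Rightarrow> real"
    using continuous_on_compose2[OF assms(1) that] by auto
  have cq: "continuous_on S (\<lambda>x. q (g x))" if "continuous_on S g" for S and g :: "real \<Rightarrow> real"
    using continuous_on_compose2[OF assms(2) that] by auto
  have cf: "continuous_on S f" for S
    unfolding f_def by (intro continuous_intros cp cq)
  have A: "((\<lambda>x. (1/2) *\<^sub>R f (x / 2)) has_integral (integral {0/2..1/2} f)) {0..1}"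
    by (rule has_integral_substitution[where c = 0 and d = 1])
       (auto intro!: cf derivative_eq_intros)
  have B: "((\<lambda>x. (1/2) *\<^sub>R f ((x + 1) / 2)) has_integral (integral {(0+1)/2..(1+1)/2} f)) {0..1}"
    by (rule has_integral_substitution[where c = 0 and d = 1])
       (auto intro!: cf derivative_eq_intros)
  have "integral {0..1/2} f + integral {1/2..1} f = integral {0..1} f"
    by (intro Henstock_Kurzweil_Integration.integral_combine integrable_continuous_real cf) auto
  with has_integral_add[OF A B]
  have "((\<lambda>x. (1/2) *\<^sub>R f (x / 2) + (1/2) *\<^sub>R f ((x + 1) / 2)) has_integral (integral {0..1} f)) {0..1}"
    by simp
  moreover have "(1/2) *\<^sub>R f (x / 2) + (1/2) *\<^sub>R f ((x + 1) / 2) = (q (x / 2) + q ((x + 1) / 2)) / 2 * p x" for x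
  proof -
    have "2 * ((x + 1) / 2) = x + 1" by simp
    then have "p (2 * ((x + 1) / 2)) = p x" using per[of x] by (simp only:)
    moreover have "p (2 * (x / 2)) = p x" by simp
    ultimately show ?thesis unfolding f_def real_scaleR_def
      by (simp only: add_divide_distrib distrib_right)
  qed
  ultimately have "integral {0..1} f = integral {0..1} (\<lambda>x. (q (x / 2) + q ((x + 1) / 2)) / 2 * p x)"
    by (metis (no_types, lifting) integral_cong integral_unique)
  then show ?thesis unfolding f_def .
qed

lemma integral_tm_weight_le: "integral {0..1} tm_weight \<le> 3/2"
proof -
  have "tm_weight x \<le> 3/2" for x
    using abs_sin_le_one[of "pi * x"] unfolding tm_weight_def by linarith
  then have "integral {0..1} tm_weight \<le> integral {0..1} (\<lambda>_::real. 3/2)"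
    by (intro integral_le integrable_continuous_real continuous_on_tm_weight[where f = "\<lambda>x. x"])
       (auto intro: continuous_intros)
  then show ?thesis by simp
qed

text \<open>Each level multiplies the integral by at most 53/40 and adds
  \<open>2 * integral {0..1} tm_weight \<le> 3\<close>. The constant -10 absorbs the addition, since
  53/40 * 10 = 13.25 exceeds 10 + 3; the coefficient 13 then fits the initial value 3.\<close>

lemma integral_tm_weight_major_le:
  "integral {0..1} (\<lambda>\<theta>. tm_weight \<theta> * tm_major k \<theta>) \<le> 13 * (53/40) ^ k - 10"
proof (induction k)
  case 0
  show ?case using integral_tm_weight_le by simp
next
  case (Suc k)
  let ?q = "\<lambda>\<theta>. 2 * \<bar>sin (pi * \<theta>)\<bar> * tm_weight \<theta>"
  have "integral {0..1} (\<lambda>\<theta>. tm_weight \<theta> * tm_major (Suc k) \<theta>) =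
        integral {0..1} (\<lambda>\<theta>. 2 * tm_weight \<theta> + ?q \<theta> * tm_major k (2 * \<theta>))"
    by (rule integral_cong) (simp add: algebra_simps)
  also have "\<dots> = 2 * integral {0..1} tm_weight + integral {0..1} (\<lambda>\<theta>. ?q \<theta> * tm_major k (2 * \<theta>))"
    by (subst integral_add) (auto intro!: integrable_continuous_real continuous_intros)
  finally have 1: "integral {0..1} (\<lambda>\<theta>. tm_weight \<theta> * tm_major (Suc k) \<theta>) =
      2 * integral {0..1} tm_weight + integral {0..1} (\<lambda>\<theta>. ?q \<theta> * tm_major k (2 * \<theta>))" .
  have "integral {0..1} (\<lambda>\<theta>. ?q \<theta> * tm_major k (2 * \<theta>)) =
      integral {0..1} (\<lambda>\<theta>. (?q (\<theta> / 2) + ?q ((\<theta> + 1) / 2)) / 2 * tm_major k \<theta>)"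
    by (rule integral_mult_double) (auto intro!: continuous_intros tm_major_plus_1)
  also have "\<dots> \<le> integral {0..1} (\<lambda>\<theta>. 53/40 * (tm_weight \<theta> * tm_major k \<theta>))"
  proof (intro integral_le integrable_continuous_real)
    fix \<theta> :: real assume "\<theta> \<in> {0..1}"
    then have "(?q (\<theta> / 2) + ?q ((\<theta> + 1) / 2)) / 2 \<le> 53/40 * tm_weight \<theta>"
      using tm_weight_transfer[of \<theta>] by simp
    from mult_right_mono[OF this tm_major_nonneg[of k \<theta>]]
    show "(?q (\<theta> / 2) + ?q ((\<theta> + 1) / 2)) / 2 * tm_major k \<theta> \<le> 53/40 * (tm_weight \<theta> * tm_major k \<theta>)"
      by (simp only: mult.assoc)
  qed (auto intro!: continuous_intros)
  also have "\<dots> \<le> 53/40 * (13 * (53/40) ^ k - 10)"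
    unfolding integral_mult_right by (rule mult_left_mono[OF Suc]) simp
  finally show ?case unfolding 1 using integral_tm_weight_le by simp
qed

lemma integral_tm_major_le: "integral {0..1} (tm_major k) \<le> 13 * (53/40) ^ k"
proof -
  have "integral {0..1} (tm_major k) \<le> integral {0..1} (\<lambda>\<theta>. tm_weight \<theta> * tm_major k \<theta>)"
  proof (intro integral_le integrable_continuous_real)
    fix \<theta> :: real
    have "1 * tm_major k \<theta> \<le> tm_weight \<theta> * tm_major k \<theta>"
      by (intro mult_right_mono tm_major_nonneg) (auto simp: tm_weight_def)
    then show "tm_major k \<theta> \<le> tm_weight \<theta> * tm_major k \<theta>" by simp
  qed (auto intro!: continuous_intros continuous_on_tm_major[where f = "\<lambda>x. x"])
  with integral_tm_weight_major_le[of k] show ?thesis by simp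
qed

section \<open>Mean values of periodic functions\<close>

text \<open>Rounding \<open>p\<close> down and \<open>q\<close> up to integers covers the interval
  by at most \<open>q - p + 2\<close> full periods.\<close>

lemma integral_periodic_le:
  fixes f :: "real \<Rightarrow> real"
  assumes cont: "continuous_on UNIV f" and per: "\<And>x. f (x + 1) = f x"
    and nonneg: "\<And>x. 0 \<le> f x" and "p \<le> q"
  shows "integral {p..q} f \<le> (q - p + 2) * integral {0..1} f"
proof -
  have int: "f integrable_on {a..b}" for a b
    using cont by (intro integrable_continuous_real) (auto intro: continuous_on_subset)
  have shift: "integral {a + 1..b + 1} f = integral {a..b} f" if "a \<le> b" for a b
  proof -
    have "((\<lambda>x. 1 *\<^sub>R f (x + 1)) has_integral (integral {a + 1..b + 1} f)) {a..b}"
      by (rule has_integral_substitution[where c = "a + 1" and d = "b + 1"])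
         (use that cont in \<open>auto intro!: derivative_eq_intros intro: continuous_on_subset\<close>)
    then show ?thesis by (simp add: per integral_unique)
  qed
  have unit: "integral {of_int m..of_int m + 1} f = integral {0..1} f" for m
  proof (induction m rule: int_induct[where k = 0])
    case (step1 i) then show ?case using shift[of "of_int i" "of_int i + 1"] by (simp add: algebra_simps)
  next
    case (step2 i) then show ?case using shift[of "of_int i - 1" "of_int i"] by (simp add: algebra_simps)
  qed auto
  have block: "integral {of_int m..of_int m + real n} f = real n * integral {0..1} f" for m n
  proof (induction n)
    case (Suc n)
    have "integral {of_int m..of_int m + real n} f + integral {of_int m + real n..of_int m + real (Suc n)} f
        = integral {of_int m..of_int m + real (Suc n)} f"
      by (intro Henstock_Kurzweil_Integration.integral_combine int) auto
    with Suc unit[of "m + int n"] show ?case by (simp add: algebra_simps)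
  qed auto
  define n where "n = nat (\<lceil>q\<rceil> - \<lfloor>p\<rfloor>)"
  have "\<lfloor>p\<rfloor> \<le> \<lceil>q\<rceil>" using assms(4) by linarith
  then have n: "real n = of_int \<lceil>q\<rceil> - of_int \<lfloor>p\<rfloor>" by (simp add: n_def)
  have "integral {p..q} f \<le> integral {of_int \<lfloor>p\<rfloor>..of_int \<lfloor>p\<rfloor> + real n} f"
    by (rule integral_subset_le) (use int nonneg n in \<open>auto intro: order_trans\<close>)
  also have "\<dots> = real n * integral {0..1} f" by (rule block)
  also have "\<dots> \<le> (q - p + 2) * integral {0..1} f"
  proof (rule mult_right_mono)
    show "real n \<le> q - p + 2" unfolding n by linarith
    show "0 \<le> integral {0..1} f" by (rule integral_nonneg) (use int nonneg in auto)
  qed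
  finally show ?thesis .
qed

text \<open>Substitution of \<open>u = g x\<close> costs the factor \<open>1 / \<mu>\<close> and
  turns the integral into one over \<open>{g A..g B}\<close>, to which the covering by full periods
  applies. Whenever a frequency moves with speed at least \<open>\<mu>\<close>, this replaces an
  average along it by the mean over a period.\<close>

lemma integral_periodic_compose_le:
  fixes f g g' :: "real \<Rightarrow> real"
  assumes cont: "continuous_on UNIV f" and per: "\<And>x. f (x + 1) = f x" and nonneg: "\<And>x. 0 \<le> f x"
    and "A \<le> B" and deriv: "\<And>x. x \<in> {A..B} \<Longrightarrow> (g has_real_derivative g' x) (at x)"
    and "0 < \<mu>" and \<mu>: "\<And>x. x \<in> {A..B} \<Longrightarrow> \<mu> \<le> g' x"
  shows "integral {A..B} (\<lambda>x. f (g x)) \<le> (g B - g A + 2) / \<mu> * integral {0..1} f"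
proof -
  have mono: "g x \<le> g y" if "A \<le> x" "x \<le> y" "y \<le> B" for x y
    using that deriv \<mu> \<open>0 < \<mu>\<close> by (intro deriv_nonneg_imp_mono[of x y g g']) (auto intro: order_trans less_imp_le)
  have int: "((\<lambda>x. g' x *\<^sub>R f (g x)) has_integral (integral {g A..g B} f)) {A..B}"
    by (rule has_integral_substitution[where c = "g A" and d = "g B"])
       (use mono \<open>A \<le> B\<close> cont deriv in \<open>auto intro: continuous_on_subset has_field_derivative_at_within\<close>)
  have cg: "continuous_on {A..B} g"
    by (rule DERIV_continuous_on, rule has_field_derivative_at_within, rule deriv)
  have "\<mu> * integral {A..B} (\<lambda>x. f (g x)) = integral {A..B} (\<lambda>x. \<mu> * f (g x))"
    by (rule integral_mult_right[symmetric])
  also have "\<dots> \<le> integral {A..B} (\<lambda>x. g' x *\<^sub>R f (g x))"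
  proof (rule integral_le)
    show "(\<lambda>x. \<mu> * f (g x)) integrable_on {A..B}"
      by (intro integrable_continuous_real continuous_intros continuous_on_compose2[OF cont cg]) auto
    show "(\<lambda>x. g' x *\<^sub>R f (g x)) integrable_on {A..B}" using int by blast
    show "\<mu> * f (g x) \<le> g' x *\<^sub>R f (g x)" if "x \<in> {A..B}" for x
      using \<mu>[OF that] nonneg[of "g x"] by (simp add: mult_right_mono)
  qed
  also have "\<dots> = integral {g A..g B} f" using int by (rule integral_unique)
  also have "\<dots> \<le> (g B - g A + 2) * integral {0..1} f"
    using mono[of A B] \<open>A \<le> B\<close> by (intro integral_periodic_le cont per nonneg) auto
  finally show ?thesis using \<open>0 < \<mu>\<close> by (simp add: field_simps)
qed

section \<open>The Fejer kernel\<close>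

definition fejer :: "nat \<Rightarrow> real \<Rightarrow> real" where
  "fejer H y = (cmod (\<Sum>n<H. cis (2 * pi * real n * y)))\<^sup>2 / real H"

lemma fejer_nonneg: "0 \<le> fejer H y"
  by (simp add: fejer_def)

lemma continuous_on_fejer [continuous_intros]:
  fixes f :: "real \<Rightarrow> real"
  shows "continuous_on S f \<Longrightarrow> continuous_on S (\<lambda>x. fejer H (f x))"
  unfolding fejer_def divide_inverse by (intro continuous_intros)

lemma cis_add_int: "cis (2 * pi * of_int k * (y + of_int m)) = cis (2 * pi * of_int k * y)"
proof -
  have "cis (2 * pi * of_int k * (y + of_int m)) =
      cis (2 * pi * of_int k * y) * cis (2 * pi * of_int (k * m))"
    by (simp add: cis_mult algebra_simps)
  also have "cis (2 * pi * of_int (k * m)) = 1"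
    by (rule cis_multiple_2pi) simp
  finally show ?thesis by simp
qed

lemma fejer_add_int: "fejer H (y + of_int m) = fejer H y"
  using cis_add_int[of "int n" y m for n] by (simp add: fejer_def)

text \<open>Adding the term \<open>z\<close> of index \<open>H\<close> to the sum \<open>D\<close>
  adds \<open>1 + 2 * Re (D * cnj z)\<close> to the squared modulus, that is 1 and one further
  cosine for each difference \<open>h = 1, ..., H\<close>.\<close>

lemma norm_cis_sum_square:
  "(cmod (\<Sum>n<H. cis (2 * pi * real n * y)))\<^sup>2 =
   real H + 2 * (\<Sum>h = 1..<H. (real H - real h) * cos (2 * pi * real h * y))"
proof (induction H)
  case (Suc H)
  define D where "D = (\<Sum>n<H. cis (2 * pi * real n * y))"
  define z where "z = cis (2 * pi * real H * y)"
  have "(cmod (D + z))\<^sup>2 = (cmod D)\<^sup>2 + 1 + 2 * Re (D * cnj z)"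
  proof -
    have "cmod z = 1" by (simp add: z_def)
    then have "(Re z)\<^sup>2 + (Im z)\<^sup>2 = 1" by (simp add: cmod_def)
    then show ?thesis unfolding cmod_power2
      by (simp add: power2_eq_square algebra_simps)
  qed
  also have "Re (D * cnj z) = (\<Sum>n<H. cos (2 * pi * real (H - n) * y))"
  proof -
    have "D * cnj z = (\<Sum>n<H. cis (2 * pi * real n * y - 2 * pi * real H * y))"
      by (simp add: D_def z_def sum_distrib_right cis_cnj cis_mult)
    also have "Re \<dots> = (\<Sum>n<H. cos (2 * pi * real (H - n) * y))"
      unfolding Re_sum
    proof (rule sum.cong)
      fix n assume "n \<in> {..<H}"
      then have "2 * pi * real (H - n) * y = - (2 * pi * real n * y - 2 * pi * real H * y)"
        by (simp add: of_nat_diff algebra_simps)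
      then show "Re (cis (2 * pi * real n * y - 2 * pi * real H * y)) = cos (2 * pi * real (H - n) * y)"
        by (simp only: cos_minus cis.sel)
    qed simp
    finally show ?thesis .
  qed
  also have "\<dots> = (\<Sum>h = 1..<Suc H. cos (2 * pi * real h * y))"
    by (rule sum.reindex_bij_witness[of _ "\<lambda>h. H - h" "\<lambda>n. H - n"]) auto
  finally have 1: "(cmod (D + z))\<^sup>2 = (cmod D)\<^sup>2 + 1 + 2 * (\<Sum>h = 1..<Suc H. cos (2 * pi * real h * y))" .
  have 2: "(\<Sum>h = 1..<Suc H. (real (Suc H) - real h) * cos (2 * pi * real h * y)) =
     (\<Sum>h = 1..<H. (real H - real h) * cos (2 * pi * real h * y)) + (\<Sum>h = 1..<Suc H. cos (2 * pi * real h * y))"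
  proof -
    have "(\<Sum>h = 1..<Suc H. (real (Suc H) - real h) * cos (2 * pi * real h * y)) =
       (\<Sum>h = 1..<Suc H. (real H - real h) * cos (2 * pi * real h * y) + cos (2 * pi * real h * y))"
      by (rule sum.cong) (simp_all add: algebra_simps)
    moreover have "(\<Sum>h = 1..<Suc H. (real H - real h) * cos (2 * pi * real h * y)) =
        (\<Sum>h = 1..<H. (real H - real h) * cos (2 * pi * real h * y))"
      by (cases "H = 0") auto
    ultimately show ?thesis by (simp only: sum.distrib)
  qed
  have "(\<Sum>n<Suc H. cis (2 * pi * real n * y)) = D + z" by (simp add: D_def z_def)
  then show ?case using 1 Suc unfolding 2 by (simp only: D_def) simp
qed simp

lemma fejer_cos_sum:
  assumes "0 < H"
  shows "fejer H y = 1 + 2 * (\<Sum>h = 1..<H. (1 - real h / real H) * cos (2 * pi * real h * y))"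
proof -
  have "(\<Sum>h = 1..<H. (1 - real h / real H) * cos (2 * pi * real h * y)) =
      (\<Sum>h = 1..<H. (real H - real h) * cos (2 * pi * real h * y)) / real H"
    unfolding sum_divide_distrib using assms by (intro sum.cong) (auto simp: field_simps)
  then show ?thesis
    using assms unfolding fejer_def norm_cis_sum_square by (simp add: field_simps)
qed

lemma fejer_minus: "fejer H (- y) = fejer H y"
  unfolding fejer_def norm_cis_sum_square by simp

text \<open>The geometric sum multiplied by \<open>1 - z\<close> is \<open>1 - z ^ H\<close>, of
  modulus at most 2, while \<open>1 - z\<close> has modulus
  \<open>2 * \<bar>sin (pi * y)\<bar>\<close>.\<close>

lemma fejer_le:
  assumes "0 < H" "sin (pi * y) \<noteq> 0"
  shows "fejer H y \<le> 1 / (real H * (sin (pi * y))\<^sup>2)"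
proof -
  define z where "z = cis (2 * pi * y)"
  have "(\<Sum>n<H. cis (2 * pi * real n * y)) = (\<Sum>n<H. z ^ n)"
    unfolding z_def Complex.DeMoivre by (intro sum.cong refl) (simp only: mult_ac)
  moreover have "(1 - z) * (\<Sum>n<H. z ^ n) = 1 - z ^ H"
    by (simp add: one_diff_power_eq)
  ultimately have "cmod (1 - z) * cmod (\<Sum>n<H. cis (2 * pi * real n * y)) = cmod (1 - z ^ H)"
    by (simp flip: norm_mult)
  also have "\<dots> \<le> 2"
    using norm_triangle_ineq4[of 1 "z ^ H"] by (simp add: norm_power z_def)
  finally have "\<bar>sin (pi * y)\<bar> * cmod (\<Sum>n<H. cis (2 * pi * real n * y)) \<le> 1"
    unfolding z_def norm_cis_minus_1 by simp
  then have "(\<bar>sin (pi * y)\<bar> * cmod (\<Sum>n<H. cis (2 * pi * real n * y)))\<^sup>2 \<le> 1"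
    by (intro power_le_one) auto
  then show ?thesis
    using assms by (simp add: fejer_def power_mult_distrib field_simps)
qed

text \<open>A weak form of Jordan's inequality: write
  \<open>sin x = 2 * sin (x / 2) * cos (x / 2)\<close>. On \<open>[0, pi / 4]\<close> the cosine is
  at least \<open>1 / sqrt 2\<close>, which by the mean value theorem also gives
  \<open>sin (x / 2) \<ge> x / 2 * (1 / sqrt 2)\<close>.\<close>

lemma sin_ge_half:
  assumes "0 \<le> x" "x \<le> pi / 2"
  shows "x / 2 \<le> sin x"
proof -
  have "1 / sqrt 2 = sqrt 2 / 2" by (simp add: field_simps)
  then have r: "1 / sqrt 2 \<le> cos t" if "0 \<le> t" "t \<le> pi / 4" for t
    using cos_monotone_0_pi_le[of t "pi / 4"] that unfolding cos_45 by simp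
  have "x / 2 * (1 / sqrt 2) \<le> sin (x / 2)"
  proof (cases "x = 0")
    case False
    then have "0 < x / 2" using assms by simp
    then obtain t where t: "0 < t" "t < x / 2" "sin (x / 2) - sin 0 = (x / 2 - 0) * cos t"
      using MVT2[of 0 "x / 2" sin cos] by (auto intro: derivative_eq_intros)
    have "x / 2 * (1 / sqrt 2) \<le> x / 2 * cos t"
      using r[of t] t assms by (intro mult_left_mono) auto
    with t show ?thesis by simp
  qed simp
  then have 1: "(x / 2 * (1 / sqrt 2)) * (1 / sqrt 2) \<le> sin (x / 2) * cos (x / 2)"
    using r[of "x / 2"] assms by (intro mult_mono) (auto intro: sin_ge_zero)
  have 2: "(x / 2 * (1 / sqrt 2)) * (1 / sqrt 2) = x / 4" by (simp add: field_simps)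
  show ?thesis using 1 sin_double[of "x / 2"] unfolding 2 by simp
qed

text \<open>After removal of the integer \<open>m\<close> all phases are at most
  \<open>pi / 3\<close> in modulus, so every cosine is at least 1/2 and the sum of \<open>R\<close>
  exponentials has modulus at least \<open>R / 2\<close>.\<close>

lemma fejer_ge:
  assumes "\<bar>y - of_int m\<bar> \<le> \<delta>" "6 * real R * \<delta> \<le> 1"
  shows "real R / 4 \<le> fejer R y"
proof (cases "R = 0")
  case False
  define w where "w = y - of_int m"
  have "1 / 2 \<le> cos (2 * pi * real n * w)" if "n < R" for n
  proof -
    have "\<bar>2 * pi * real n * w\<bar> = 2 * pi * (real n * \<bar>w\<bar>)" by (simp add: abs_mult)
    also have "\<dots> \<le> 2 * pi * (real R * \<delta>)"
      using that assms(1) by (intro mult_left_mono mult_mono) (auto simp: w_def)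
    also have "\<dots> \<le> 2 * pi * (1 / 6)"
      using assms(2) by (intro mult_left_mono) auto
    finally have "\<bar>2 * pi * real n * w\<bar> \<le> pi / 3" by simp
    then have "cos (pi / 3) \<le> cos \<bar>2 * pi * real n * w\<bar>"
      by (intro cos_monotone_0_pi_le) auto
    then show ?thesis by (simp add: cos_60)
  qed
  then have "(\<Sum>n<R. 1 / 2) \<le> (\<Sum>n<R. cos (2 * pi * real n * w))"
    by (intro sum_mono) auto
  also have "\<dots> = Re (\<Sum>n<R. cis (2 * pi * real n * w))" by simp
  also have "\<dots> \<le> cmod (\<Sum>n<R. cis (2 * pi * real n * w))" by (rule complex_Re_le_cmod)
  finally have "real R / 2 \<le> cmod (\<Sum>n<R. cis (2 * pi * real n * w))" by simp
  then have "(real R / 2)\<^sup>2 / real R \<le> fejer R w"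
    unfolding fejer_def by (intro divide_right_mono power_mono) auto
  moreover have "fejer R w = fejer R y"
    using fejer_add_int[of R w m] by (simp add: w_def)
  ultimately show ?thesis using False by (simp add: power2_eq_square)
qed (simp add: fejer_nonneg)

section \<open>The smoothed sawtooth\<close>

text \<open>The primitive of \<open>fejer H\<close> that vanishes at 0. It is a smooth approximation
  to the staircase \<open>\<lceil>y\<rceil> - 1 / 2\<close>, and its difference from
  \<open>y\<close> is a trigonometric polynomial of degree less than \<open>H\<close>.\<close>

definition fejer_prim :: "nat \<Rightarrow> real \<Rightarrow> real" where
  "fejer_prim H y = y + (\<Sum>h = 1..<H. (1 - real h / real H) * sin (2 * pi * real h * y) / (pi * real h))"

lemma DERIV_fejer_prim:
  assumes "0 < H"
  shows "(fejer_prim H has_real_derivative fejer H y) (at y)"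
proof -
  have "((\<lambda>y. y + (\<Sum>h = 1..<H. (1 - real h / real H) * sin (2 * pi * real h * y) / (pi * real h)))
      has_real_derivative (1 + (\<Sum>h = 1..<H. 2 * ((1 - real h / real H) * cos (2 * pi * real h * y))))) (at y)"
    by (auto intro!: derivative_eq_intros sum.cong)
  then show ?thesis
    unfolding fejer_cos_sum[OF assms] sum_distrib_left fejer_prim_def[abs_def] .
qed

lemma fejer_prim_add_int: "fejer_prim H (y + of_int m) = fejer_prim H y + of_int m"
proof -
  have "sin (2 * pi * real h * (y + of_int m)) = sin (2 * pi * real h * y)" for h
    using cis_add_int[of "int h" y m] by (simp add: complex_eq_iff)
  then show ?thesis by (simp add: fejer_prim_def)
qed

lemma fejer_prim_0 [simp]: "fejer_prim H 0 = 0"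
  by (simp add: fejer_prim_def)

lemma fejer_prim_half [simp]: "fejer_prim H (1 / 2) = 1 / 2"
proof -
  have "sin (2 * pi * real h * (1 / 2)) = 0" for h
    using sin_npi[of h] by (simp add: mult.commute)
  then show ?thesis by (simp add: fejer_prim_def)
qed

lemma fejer_prim_mono:
  assumes "0 < H" "x \<le> y"
  shows "fejer_prim H x \<le> fejer_prim H y"
  by (rule deriv_nonneg_imp_mono[where g' = "fejer H"])
     (use assms in \<open>auto intro: DERIV_fejer_prim fejer_nonneg\<close>)

lemma integral_fejer:
  assumes "0 < H"
  shows "integral {0..1} (fejer H) = 1"
proof -
  have "(fejer H has_integral (fejer_prim H 1 - fejer_prim H 0)) {0..1}"
    by (rule fundamental_theorem_of_calculus)
       (auto simp flip: has_real_derivative_iff_has_vector_derivative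
         intro: has_field_derivative_at_within[OF DERIV_fejer_prim[OF assms]])
  then show ?thesis using fejer_prim_add_int[of H 0 1] by (simp add: integral_unique)
qed

text \<open>After translation to the cell \<open>(0, 1]\<close> the staircase equals 1/2, and the
  primitive of the nonnegative kernel increases from 0 to 1 there.\<close>

lemma ceiling_minus_fejer_prim_bound:
  assumes "0 < H"
  shows "\<bar>of_int \<lceil>y\<rceil> - 1 / 2 - fejer_prim H y\<bar> \<le> 1 / 2"
proof -
  define w where "w = y - of_int (\<lceil>y\<rceil> - 1)"
  have w: "0 \<le> w" "w \<le> 1" unfolding w_def by linarith+
  have "fejer_prim H y = fejer_prim H w + of_int (\<lceil>y\<rceil> - 1)"
    using fejer_prim_add_int[of H w "\<lceil>y\<rceil> - 1"] by (simp add: w_def)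
  moreover have "fejer_prim H 0 \<le> fejer_prim H w" "fejer_prim H w \<le> fejer_prim H 1"
    using w assms by (intro fejer_prim_mono; simp)+
  moreover have "fejer_prim H 1 = 1" using fejer_prim_add_int[of H 0 1] by simp
  ultimately show ?thesis unfolding fejer_prim_0 abs_le_iff by simp
qed

text \<open>On the cell \<open>(0, 1]\<close> the staircase is constantly 1/2, which is the value of
  the primitive at the midpoint. Between the midpoint and a point at distance at least
  \<open>\<epsilon>\<close> from the integers the kernel is at most
  \<open>1 / (H * \<epsilon>^2)\<close>, so the primitive moves by no more than that.\<close>

lemma ceiling_minus_fejer_prim_small:
  assumes "0 < H" "0 < \<epsilon>" and far: "\<And>m::int. \<epsilon> \<le> \<bar>y - of_int m\<bar>"
  shows "\<bar>of_int \<lceil>y\<rceil> - 1 / 2 - fejer_prim H y\<bar> \<le> 1 / (real H * \<epsilon>\<^sup>2)"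
proof -
  define w where "w = y - of_int (\<lceil>y\<rceil> - 1)"
  have "0 < w" "w \<le> 1" unfolding w_def by linarith+
  then have w: "\<epsilon> \<le> w" "w \<le> 1 - \<epsilon>"
    using far[of "\<lceil>y\<rceil> - 1"] far[of "\<lceil>y\<rceil>"] by (auto simp: w_def)
  have F: "\<bar>fejer H t\<bar> \<le> 1 / (real H * \<epsilon>\<^sup>2)" if "\<epsilon> \<le> t" "t \<le> 1 - \<epsilon>" for t
  proof -
    \<comment> \<open>The symmetry of \<open>sin (pi * t)\<close> under \<open>t\<close> to
      \<open>1 - t\<close> reduces to \<open>s \<le> 1 / 2\<close>, where
      \<open>sin (pi * s) \<ge> pi * s / 2 \<ge> s\<close>.\<close>
    have "\<epsilon> \<le> sin (pi * t)"
    proof -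
      define s where "s = min t (1 - t)"
      have s: "\<epsilon> \<le> s" "s \<le> 1 / 2" using that unfolding s_def by linarith+
      have "\<epsilon> \<le> pi * s / 2"
        using s pi_ge_two mult_right_mono[of 2 pi s] assms by linarith
      also have "pi * s / 2 \<le> sin (pi * s)"
        using s assms by (intro sin_ge_half) auto
      also have "sin (pi * s) = sin (pi * t)"
        by (simp add: s_def min_def right_diff_distrib)
      finally show ?thesis .
    qed
    then have "1 / (real H * (sin (pi * t))\<^sup>2) \<le> 1 / (real H * \<epsilon>\<^sup>2)"
      using assms by (intro divide_left_mono mult_left_mono power_mono mult_pos_pos) auto
    moreover have "fejer H t \<le> 1 / (real H * (sin (pi * t))\<^sup>2)"
      using \<open>\<epsilon> \<le> sin (pi * t)\<close> assms by (intro fejer_le) auto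
    ultimately show ?thesis using fejer_nonneg[of H t] by simp
  qed
  have "norm (fejer_prim H w - fejer_prim H (1 / 2)) \<le> 1 / (real H * \<epsilon>\<^sup>2) * norm (w - 1 / 2)"
  proof (rule field_differentiable_bound[of "{\<epsilon>..1 - \<epsilon>}" "fejer_prim H" "fejer H"])
    show "(fejer_prim H has_real_derivative fejer H t) (at t within {\<epsilon>..1 - \<epsilon>})" for t
      by (rule has_field_derivative_at_within[OF DERIV_fejer_prim[OF assms(1)]])
    show "norm (fejer H t) \<le> 1 / (real H * \<epsilon>\<^sup>2)" if "t \<in> {\<epsilon>..1 - \<epsilon>}" for t
      using F[of t] that by simp
    show "w \<in> {\<epsilon>..1 - \<epsilon>}" "1 / 2 \<in> {\<epsilon>..1 - \<epsilon>}"
      using w by simp_all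
  qed simp
  also have "\<dots> \<le> 1 / (real H * \<epsilon>\<^sup>2) * 1"
    using w assms(2) by (intro mult_left_mono) (auto simp: abs_le_iff)
  finally have "\<bar>fejer_prim H w - 1 / 2\<bar> \<le> 1 / (real H * \<epsilon>\<^sup>2)" by simp
  moreover have "fejer_prim H y = fejer_prim H w + of_int (\<lceil>y\<rceil> - 1)"
    using fejer_prim_add_int[of H w "\<lceil>y\<rceil> - 1"] by (simp add: w_def)
  ultimately show ?thesis by (simp add: abs_minus_commute)
qed

section \<open>Points of an arithmetic progression close to integers\<close>

lemma fejer_double_sum:
  "complex_of_real (real H * fejer H y) = (\<Sum>p<H. \<Sum>q<H. cis (2 * pi * (real p - real q) * y))"
proof -
  define D where "D = (\<Sum>n<H. cis (2 * pi * real n * y))"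
  have "complex_of_real (real H * fejer H y) = D * cnj D"
    unfolding complex_norm_square[symmetric]
    by (cases "H = 0") (simp_all add: fejer_def D_def)
  also have "\<dots> = (\<Sum>p<H. \<Sum>q<H. cis (2 * pi * (real p - real q) * y))"
    by (simp add: D_def sum_product cis_cnj cis_mult algebra_simps)
  finally show ?thesis .
qed

text \<open>The count is majorised by Fejer kernels twice: \<open>fejer R\<close> detects closeness to an integer,
  and the triangular weights of \<open>fejer (2 * K)\<close> majorise the window \<open>r < K\<close>.\<close>

lemma card_near_int_le:
  assumes "0 < R" "6 * real R * \<delta> \<le> 1" "0 < K"
  shows "real (card {r \<in> {..<K}. \<exists>m::int. \<bar>y + \<alpha> * real r - of_int m\<bar> \<le> \<delta>}) \<le>
    8 / (real R)\<^sup>2 * (\<Sum>p<R. \<Sum>q<R. fejer (2 * K) ((real p - real q) * \<alpha>))"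
proof -
  define g where "g s = fejer R (y + \<alpha> * s)" for s
  define Q where "Q = 2 * K"
  let ?B = "{r \<in> {..<K}. \<exists>m::int. \<bar>y + \<alpha> * real r - of_int m\<bar> \<le> \<delta>}"
  have "real (card ?B) * (real R / 4) = (\<Sum>r\<in>?B. real R / 4)" by simp
  also have "\<dots> \<le> (\<Sum>r\<in>?B. g (real r))"
    unfolding g_def using fejer_ge[OF _ assms(2)] by (intro sum_mono) blast
  also have "\<dots> \<le> (\<Sum>r<K. g (real r))"
    by (intro sum_mono2) (auto simp: g_def fejer_nonneg)
  finally have 1: "real (card ?B) * (real R / 4) \<le> (\<Sum>r<K. g (real r))" .
  \<comment> \<open>For every \<open>b < K\<close>, each \<open>r < K\<close> is a difference
    \<open>a - b\<close> with \<open>a < 2 * K\<close>. The full square \<open>a, b < Q\<close> adds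
    only nonnegative terms and factors into exponential sums.\<close>
  have "real K * (\<Sum>r<K. g (real r)) = (\<Sum>b<K. \<Sum>r<K. g (real r))" by simp
  also have "\<dots> \<le> (\<Sum>b<K. \<Sum>a<Q. g (real a - real b))"
  proof (rule sum_mono)
    fix b assume b: "b \<in> {..<K}"
    have "(\<Sum>r<K. g (real r)) = (\<Sum>a\<in>(\<lambda>r. r + b) ` {..<K}. g (real a - real b))"
      by (subst sum.reindex) auto
    also have "\<dots> \<le> (\<Sum>a<Q. g (real a - real b))"
      using b by (intro sum_mono2) (auto simp: g_def fejer_nonneg Q_def)
    finally show "(\<Sum>r<K. g (real r)) \<le> (\<Sum>a<Q. g (real a - real b))" .
  qed
  also have "\<dots> \<le> (\<Sum>b<Q. \<Sum>a<Q. g (real a - real b))"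
    by (intro sum_mono2) (auto simp: g_def fejer_nonneg Q_def intro: sum_nonneg)
  finally have 2: "real K * (\<Sum>r<K. g (real r)) \<le> (\<Sum>b<Q. \<Sum>a<Q. g (real a - real b))" .
  have "complex_of_real (real R * (\<Sum>b<Q. \<Sum>a<Q. g (real a - real b))) =
      (\<Sum>b<Q. \<Sum>a<Q. complex_of_real (real R * fejer R (y + \<alpha> * (real a - real b))))"
    by (simp add: g_def sum_distrib_left)
  also have "\<dots> = (\<Sum>b<Q. \<Sum>a<Q. \<Sum>p<R. \<Sum>q<R. cis (2 * pi * (real p - real q) * (y + \<alpha> * (real a - real b))))"
    by (simp only: fejer_double_sum)
  also have "\<dots> = (\<Sum>p<R. \<Sum>q<R. \<Sum>b<Q. \<Sum>a<Q. cis (2 * pi * (real p - real q) * (y + \<alpha> * (real a - real b))))"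
    by (simp only: sum.swap[of _ "{..<R}" "{..<Q}"])
  \<comment> \<open>The offset \<open>y\<close> survives only as a factor of modulus 1 for each pair
    \<open>p\<close>, \<open>q\<close>, and taking norms removes it.\<close>
  also have "\<dots> = (\<Sum>p<R. \<Sum>q<R. cis (2 * pi * (real p - real q) * y) *
      complex_of_real (real Q * fejer Q ((real p - real q) * \<alpha>)))"
  proof (intro sum.cong refl)
    fix p q
    have "cis (2 * pi * (real p - real q) * (y + \<alpha> * (real a - real b))) =
        cis (2 * pi * (real p - real q) * y) * cis (2 * pi * (real a - real b) * ((real p - real q) * \<alpha>))" for a b
      by (simp add: cis_mult algebra_simps)
    then have "(\<Sum>b<Q. \<Sum>a<Q. cis (2 * pi * (real p - real q) * (y + \<alpha> * (real a - real b)))) =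
      cis (2 * pi * (real p - real q) * y) *
      (\<Sum>b<Q. \<Sum>a<Q. cis (2 * pi * (real a - real b) * ((real p - real q) * \<alpha>)))"
      by (simp only: sum_distrib_left)
    also have "(\<Sum>b<Q. \<Sum>a<Q. cis (2 * pi * (real a - real b) * ((real p - real q) * \<alpha>))) =
        complex_of_real (real Q * fejer Q ((real p - real q) * \<alpha>))"
      by (subst sum.swap) (simp only: fejer_double_sum)
    finally show "(\<Sum>b<Q. \<Sum>a<Q. cis (2 * pi * (real p - real q) * (y + \<alpha> * (real a - real b)))) =
      cis (2 * pi * (real p - real q) * y) * complex_of_real (real Q * fejer Q ((real p - real q) * \<alpha>))" .
  qed
  finally have "cmod (complex_of_real (real R * (\<Sum>b<Q. \<Sum>a<Q. g (real a - real b)))) = cmod \<dots>"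
    by (rule arg_cong)
  also have "\<dots> \<le> (\<Sum>p<R. \<Sum>q<R. real Q * fejer Q ((real p - real q) * \<alpha>))"
    by (intro order_trans[OF norm_sum] sum_mono) (simp add: norm_mult fejer_nonneg)
  also have "\<dots> = real Q * (\<Sum>p<R. \<Sum>q<R. fejer Q ((real p - real q) * \<alpha>))"
    by (simp only: sum_distrib_left)
  finally have 3: "real R * (\<Sum>b<Q. \<Sum>a<Q. g (real a - real b)) \<le>
      real Q * (\<Sum>p<R. \<Sum>q<R. fejer Q ((real p - real q) * \<alpha>))" (is "_ \<le> real Q * ?S")
    unfolding norm_of_real by linarith
  have "real R * (real K * (real (card ?B) * (real R / 4))) \<le> real R * (real K * (\<Sum>r<K. g (real r)))"
    using 1 by (intro mult_left_mono) auto
  also have "\<dots> \<le> real R * (\<Sum>b<Q. \<Sum>a<Q. g (real a - real b))"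
    using 2 by (intro mult_left_mono) auto
  also have "\<dots> \<le> real Q * ?S" by (rule 3)
  finally have "real (card ?B) * (real R)\<^sup>2 * real K \<le> 8 * ?S * real K"
    by (simp add: Q_def power2_eq_square mult_ac)
  then have "real (card ?B) * (real R)\<^sup>2 \<le> 8 * ?S"
    using assms(3) by simp
  then show ?thesis using assms(1) by (simp add: Q_def field_simps)
qed

section \<open>Beatty sequences\<close>

lemma real_nat_floor:
  assumes "0 \<le> x"
  shows "real (nat \<lfloor>x\<rfloor>) \<le> x" "x < real (nat \<lfloor>x\<rfloor>) + 1"
proof -
  have "real (nat \<lfloor>x\<rfloor>) = of_int \<lfloor>x\<rfloor>" using assms by simp
  then show "real (nat \<lfloor>x\<rfloor>) \<le> x" "x < real (nat \<lfloor>x\<rfloor>) + 1" by linarith+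
qed

text \<open>The value \<open>m\<close> is taken at the integers \<open>n\<close> with
  \<open>(m - y) / \<alpha> \<le> n < (m + 1 - y) / \<alpha>\<close>, whose number is a difference
  of two ceilings. As \<open>\<alpha> > 1\<close>, an \<open>n \<le> 0\<close> gives a value below
  \<open>a\<close> and an \<open>n > K\<close> a value of at least \<open>b\<close>, so no boundary
  correction arises.\<close>

lemma sum_beatty_eq:
  fixes f :: "nat \<Rightarrow> real" and \<alpha> y :: real and K :: nat
  assumes \<alpha>: "1 < \<alpha>" and y: "0 \<le> y + \<alpha>" and K: "1 \<le> K"
  defines "a \<equiv> nat \<lfloor>y + \<alpha>\<rfloor>" and "b \<equiv> Suc (nat \<lfloor>y + \<alpha> * real K\<rfloor>)"
  shows "(\<Sum>r = 1..K. f (nat \<lfloor>y + \<alpha> * real r\<rfloor>)) =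
    (\<Sum>m = a..<b. f m * of_int (\<lceil>(real (Suc m) - y) / \<alpha>\<rceil> - \<lceil>(real m - y) / \<alpha>\<rceil>))"
proof -
  define l where "l r = nat \<lfloor>y + \<alpha> * real r\<rfloor>" for r
  have nonneg: "0 \<le> y + \<alpha> * real r" if "1 \<le> r" for r
  proof -
    have "\<alpha> * 1 \<le> \<alpha> * real r" using that \<alpha> by (intro mult_left_mono) auto
    then show ?thesis using y by linarith
  qed
  have card: "real (card {r \<in> {1..K}. l r = m}) =
      of_int (\<lceil>(real (Suc m) - y) / \<alpha>\<rceil> - \<lceil>(real m - y) / \<alpha>\<rceil>)" if m: "m \<in> {a..<b}" for m
  proof -
    let ?I = "{\<lceil>(real m - y) / \<alpha>\<rceil>..<\<lceil>(real (Suc m) - y) / \<alpha>\<rceil>}"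
    have mem: "n \<in> ?I \<longleftrightarrow> real m \<le> y + \<alpha> * of_int n \<and> y + \<alpha> * of_int n < real m + 1" for n
    proof -
      have "n \<in> ?I \<longleftrightarrow> (real m - y) / \<alpha> \<le> of_int n \<and> of_int n < (real (Suc m) - y) / \<alpha>"
        by (auto simp: ceiling_le_iff less_ceiling_iff)
      then show ?thesis using \<alpha> by (auto simp: field_simps)
    qed
    have a: "real a \<le> y + \<alpha>" "y + \<alpha> < real a + 1" "real b \<le> y + \<alpha> * real K + 1"
      using real_nat_floor[OF y] real_nat_floor[OF nonneg[OF K]] unfolding a_def b_def by auto
    have "int ` {r \<in> {1..K}. l r = m} = ?I"
    proof (intro equalityI subsetI)
      fix n assume "n \<in> int ` {r \<in> {1..K}. l r = m}"
      then obtain r where r: "n = int r" "1 \<le> r" "r \<le> K" "l r = m" by auto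
      have "0 \<le> \<lfloor>y + \<alpha> * real r\<rfloor>" using nonneg[OF r(2)] by simp
      with r(4) have "\<lfloor>y + \<alpha> * real r\<rfloor> = int m" unfolding l_def by linarith
      then have "real m \<le> y + \<alpha> * real r \<and> y + \<alpha> * real r < real m + 1" by linarith
      then show "n \<in> ?I" unfolding mem r(1) by simp
    next
      fix n assume "n \<in> ?I"
      then have n: "real m \<le> y + \<alpha> * of_int n" "y + \<alpha> * of_int n < real m + 1"
        unfolding mem by auto
      have "1 \<le> n"
      proof (rule ccontr)
        assume "\<not> 1 \<le> n"
        then have "\<alpha> * of_int n \<le> \<alpha> * 0" using \<alpha> by (intro mult_left_mono) auto
        then have "real m \<le> y" using n by simp
        moreover have "real a \<le> real m" using m by simp
        ultimately show False using a \<alpha> by linarith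
      qed
      have "n \<le> int K"
      proof (rule ccontr)
        assume "\<not> n \<le> int K"
        then have "int K + 1 \<le> n" by simp
        then have "of_int (int K + 1) \<le> (of_int n :: real)" by (simp only: of_int_le_iff)
        then have "\<alpha> * (real K + 1) \<le> \<alpha> * of_int n" using \<alpha> by (intro mult_left_mono) auto
        then have lt: "y + \<alpha> * real K + \<alpha> < real m + 1" using n by (simp add: algebra_simps)
        have "real m + 1 \<le> real b" using m by (simp add: Suc_le_eq[symmetric] flip: of_nat_Suc)
        then show False using lt a(3) \<alpha> by linarith
      qed
      from n have "\<lfloor>y + \<alpha> * of_int n\<rfloor> = int m" by (simp add: floor_eq_iff)
      with \<open>1 \<le> n\<close> \<open>n \<le> int K\<close> show "n \<in> int ` {r \<in> {1..K}. l r = m}"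
        by (intro image_eqI[of _ _ "nat n"]) (auto simp: l_def)
    qed
    moreover have "card (int ` {r \<in> {1..K}. l r = m}) = card {r \<in> {1..K}. l r = m}"
      by (rule card_image) simp
    ultimately have "card {r \<in> {1..K}. l r = m} = card ?I" by simp
    moreover have "\<lceil>(real m - y) / \<alpha>\<rceil> \<le> \<lceil>(real (Suc m) - y) / \<alpha>\<rceil>"
      using \<alpha> by (intro ceiling_mono divide_right_mono) auto
    ultimately show ?thesis by simp
  qed
  have "l ` {1..K} \<subseteq> {a..<b}"
  proof
    fix m assume "m \<in> l ` {1..K}"
    then obtain r where r: "1 \<le> r" "r \<le> K" "m = l r" by auto
    have "\<alpha> * 1 \<le> \<alpha> * real r" "\<alpha> * real r \<le> \<alpha> * real K"
      using r \<alpha> by (intro mult_left_mono; simp)+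
    then have "\<lfloor>y + \<alpha>\<rfloor> \<le> \<lfloor>y + \<alpha> * real r\<rfloor>" "\<lfloor>y + \<alpha> * real r\<rfloor> \<le> \<lfloor>y + \<alpha> * real K\<rfloor>"
      by (intro floor_mono; simp)+
    then show "m \<in> {a..<b}" unfolding r(3) l_def a_def b_def by (auto simp: nat_mono less_Suc_eq_le)
  qed
  then have "(\<Sum>r = 1..K. f (l r)) = (\<Sum>m = a..<b. \<Sum>r\<in>{r \<in> {1..K}. l r = m}. f (l r))"
    by (intro sum.group[symmetric]) auto
  also have "\<dots> = (\<Sum>m = a..<b. f m * real (card {r \<in> {1..K}. l r = m}))"
    by (intro sum.cong) auto
  also have "\<dots> = (\<Sum>m = a..<b. f m * of_int (\<lceil>(real (Suc m) - y) / \<alpha>\<rceil> - \<lceil>(real m - y) / \<alpha>\<rceil>))"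
    using card by (intro sum.cong) auto
  finally show ?thesis unfolding l_def .
qed

text \<open>Each sine in \<open>fejer_prim\<close> contributes an increment that is the imaginary
  part of a fixed number \<open>w h\<close> times \<open>cis (2 * pi * m * h / \<alpha>)\<close>.
  Summation over \<open>m\<close> therefore produces the exponential sum
  \<open>T (h / \<alpha>)\<close>. The linear part has increment \<open>1 / \<alpha>\<close> and
  produces \<open>T 0\<close>, of modulus at most 2.\<close>

lemma sum_tm_fejer_prim_le:
  assumes \<alpha>: "0 < \<alpha>" and "b \<le> a + 2 ^ k"
  shows "\<bar>\<Sum>m = a..<b. tm m * (fejer_prim H ((real (Suc m) - y) / \<alpha>) - fejer_prim H ((real m - y) / \<alpha>))\<bar>
    \<le> 2 / \<alpha> + (\<Sum>h = 1..<H. min (1 / real h) (2 / \<alpha>) * tm_major k (real h / \<alpha>))"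
proof -
  define T where "T \<theta> = (\<Sum>m = a..<b. of_real (tm m) * cis (2 * pi * real m * \<theta>))" for \<theta>
  \<comment> \<open>The offset \<open>y\<close> enters only through the first factor, which has
    modulus 1. The second has modulus \<open>2 * \<bar>sin (pi * h / \<alpha>)\<bar>\<close>; the
    bounds 2 and \<open>2 * pi * h / \<alpha>\<close> for it yield the two entries of the
    minimum.\<close>
  define w where "w h = cis (2 * pi * real h * (1 - y) / \<alpha>) * (1 - cis (2 * pi * (- (real h / \<alpha>))))" for h
  have T: "cmod (T \<theta>) \<le> tm_major k \<theta>" for \<theta>
    unfolding T_def using assms(2) by (rule norm_tm_exp_sum_le)
  have w: "cmod (w h) \<le> pi * real h * min (1 / real h) (2 / \<alpha>)" if "1 \<le> h" for h
  proof -
    have "cmod (w h) = 2 * \<bar>sin (pi * (real h / \<alpha>))\<bar>"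
      by (simp add: w_def norm_mult norm_cis_minus_1[of "- (real h / \<alpha>)", simplified])
    moreover have "2 * \<bar>sin (pi * (real h / \<alpha>))\<bar> \<le> pi"
      using abs_sin_le_one[of "pi * (real h / \<alpha>)"] pi_ge_two by linarith
    moreover have "\<bar>sin (pi * (real h / \<alpha>))\<bar> \<le> \<bar>pi * (real h / \<alpha>)\<bar>"
      by (rule abs_sin_x_le_abs_x)
    moreover have "\<bar>pi * (real h / \<alpha>)\<bar> = pi * (real h / \<alpha>)" using \<alpha> by simp
    moreover have "pi * real h * min (1 / real h) (2 / \<alpha>) = min pi (2 * (pi * (real h / \<alpha>)))"
      using that \<alpha> by (simp add: min_mult_distrib_left mult_ac)
    ultimately show ?thesis by linarith
  qed
  have id: "fejer_prim H ((real (Suc m) - y) / \<alpha>) - fejer_prim H ((real m - y) / \<alpha>) =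
      1 / \<alpha> + (\<Sum>h = 1..<H. (1 - real h / real H) / (pi * real h) * Im (w h * cis (2 * pi * real m * (real h / \<alpha>))))" for m
  proof -
    have "sin (2 * pi * real h * ((real (Suc m) - y) / \<alpha>)) - sin (2 * pi * real h * ((real m - y) / \<alpha>)) =
        Im (w h * cis (2 * pi * real m * (real h / \<alpha>)))" for h
    proof -
      have "w h * cis (2 * pi * real m * (real h / \<alpha>)) =
        cis (2 * pi * real h * (1 - y) / \<alpha> + 2 * pi * real m * (real h / \<alpha>)) -
        cis (2 * pi * real h * (1 - y) / \<alpha> + 2 * pi * (- (real h / \<alpha>)) + 2 * pi * real m * (real h / \<alpha>))"
        by (simp add: w_def cis_mult right_diff_distrib left_diff_distrib)
      also have "2 * pi * real h * (1 - y) / \<alpha> + 2 * pi * real m * (real h / \<alpha>) =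
          2 * pi * real h * ((real (Suc m) - y) / \<alpha>)"
        using \<alpha> by (simp add: field_simps)
      also have "2 * pi * real h * (1 - y) / \<alpha> + 2 * pi * (- (real h / \<alpha>)) + 2 * pi * real m * (real h / \<alpha>) =
          2 * pi * real h * ((real m - y) / \<alpha>)"
        using \<alpha> by (simp add: field_simps)
      finally show ?thesis by simp
    qed
    note s = this[symmetric]
    have "(real (Suc m) - y) / \<alpha> - (real m - y) / \<alpha> = 1 / \<alpha>"
      by (simp add: diff_divide_distrib[symmetric])
    moreover have "fejer_prim H p - fejer_prim H q = (p - q) +
        (\<Sum>h = 1..<H. (1 - real h / real H) / (pi * real h) * (sin (2 * pi * real h * p) - sin (2 * pi * real h * q)))" for p q
    proof -
      have "(1 - real h / real H) / (pi * real h) * (sin (2 * pi * real h * p) - sin (2 * pi * real h * q)) =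
          (1 - real h / real H) * sin (2 * pi * real h * p) / (pi * real h) -
          (1 - real h / real H) * sin (2 * pi * real h * q) / (pi * real h)" for h
        unfolding right_diff_distrib by (simp only: times_divide_eq_left)
      then show ?thesis unfolding fejer_prim_def by (simp only: sum_subtractf)
    qed
    ultimately show ?thesis unfolding s by (simp only:)
  qed
  have "(\<Sum>m = a..<b. tm m * (fejer_prim H ((real (Suc m) - y) / \<alpha>) - fejer_prim H ((real m - y) / \<alpha>))) =
      (\<Sum>m = a..<b. tm m * (1 / \<alpha>)) + (\<Sum>m = a..<b. \<Sum>h = 1..<H. tm m *
        ((1 - real h / real H) / (pi * real h) * Im (w h * cis (2 * pi * real m * (real h / \<alpha>)))))"
    unfolding id by (simp add: distrib_left sum.distrib sum_distrib_left)
  also have "(\<Sum>m = a..<b. tm m * (1 / \<alpha>)) = Re (T 0) / \<alpha>"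
    by (simp add: T_def sum_divide_distrib)
  also have "(\<Sum>m = a..<b. \<Sum>h = 1..<H. tm m *
        ((1 - real h / real H) / (pi * real h) * Im (w h * cis (2 * pi * real m * (real h / \<alpha>))))) =
      (\<Sum>h = 1..<H. (1 - real h / real H) / (pi * real h) * Im (w h * T (real h / \<alpha>)))"
  proof (subst sum.swap, rule sum.cong)
    fix h
    have "Im (w h * T (real h / \<alpha>)) = (\<Sum>m = a..<b. tm m * Im (w h * cis (2 * pi * real m * (real h / \<alpha>))))"
      unfolding T_def sum_distrib_left Im_sum
      by (intro sum.cong refl) (simp add: algebra_simps)
    then show "(\<Sum>m = a..<b. tm m *
        ((1 - real h / real H) / (pi * real h) * Im (w h * cis (2 * pi * real m * (real h / \<alpha>))))) =
      (1 - real h / real H) / (pi * real h) * Im (w h * T (real h / \<alpha>))"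
      by (simp only: sum_distrib_left mult_ac)
  qed simp
  finally have eq: "(\<Sum>m = a..<b. tm m * (fejer_prim H ((real (Suc m) - y) / \<alpha>) - fejer_prim H ((real m - y) / \<alpha>))) =
      Re (T 0) / \<alpha> + (\<Sum>h = 1..<H. (1 - real h / real H) / (pi * real h) * Im (w h * T (real h / \<alpha>)))" .
  have "\<bar>Re (T 0) / \<alpha>\<bar> \<le> 2 / \<alpha>"
    using abs_Re_le_cmod[of "T 0"] T[of 0] \<alpha> by (simp add: abs_divide divide_right_mono)
  moreover have "\<bar>\<Sum>h = 1..<H. (1 - real h / real H) / (pi * real h) * Im (w h * T (real h / \<alpha>))\<bar> \<le>
      (\<Sum>h = 1..<H. min (1 / real h) (2 / \<alpha>) * tm_major k (real h / \<alpha>))"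
  proof (rule order_trans[OF sum_abs sum_mono])
    fix h assume h: "h \<in> {1..<H}"
    have "\<bar>Im (w h * T (real h / \<alpha>))\<bar> \<le> cmod (w h) * cmod (T (real h / \<alpha>))"
      using abs_Im_le_cmod[of "w h * T (real h / \<alpha>)"] by (simp add: norm_mult)
    also have "\<dots> \<le> (pi * real h * min (1 / real h) (2 / \<alpha>)) * tm_major k (real h / \<alpha>)"
      using w[of h] T h \<alpha> by (intro mult_mono) auto
    finally have 1: "\<bar>Im (w h * T (real h / \<alpha>))\<bar> \<le> (pi * real h * min (1 / real h) (2 / \<alpha>)) * tm_major k (real h / \<alpha>)" .
    have "\<bar>(1 - real h / real H) / (pi * real h)\<bar> \<le> 1 / (pi * real h)"
      using h by (simp add: abs_divide divide_right_mono)
    then have "\<bar>(1 - real h / real H) / (pi * real h) * Im (w h * T (real h / \<alpha>))\<bar> \<le>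
        1 / (pi * real h) * ((pi * real h * min (1 / real h) (2 / \<alpha>)) * tm_major k (real h / \<alpha>))"
      unfolding abs_mult using 1 by (intro mult_mono) auto
    also have "\<dots> = min (1 / real h) (2 / \<alpha>) * tm_major k (real h / \<alpha>)"
      using h by simp
    finally show "\<bar>(1 - real h / real H) / (pi * real h) * Im (w h * T (real h / \<alpha>))\<bar> \<le>
        min (1 / real h) (2 / \<alpha>) * tm_major k (real h / \<alpha>)" .
  qed
  ultimately show ?thesis unfolding eq by (intro order_trans[OF abs_triangle_ineq add_mono])
qed

text \<open>The smoothing error is small unless \<open>(m - y) / \<alpha>\<close> is within
  \<open>\<delta> / \<alpha>\<close> of an integer \<open>n\<close>. In that case \<open>m\<close>
  is within \<open>\<delta>\<close> of \<open>y + \<alpha> * n\<close>, so such \<open>m\<close> are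
  counted by the points of the progression that are close to integers.\<close>

lemma sum_sawtooth_error_le:
  fixes \<alpha> y \<delta> :: real and H K :: nat
  assumes \<alpha>: "1 < \<alpha>" and "0 \<le> y + \<alpha>" "0 < H" "0 < \<delta>" "\<delta> < 1 / 2" "1 \<le> K"
  defines "a \<equiv> nat \<lfloor>y + \<alpha>\<rfloor>" and "b \<equiv> Suc (nat \<lfloor>y + \<alpha> * real K\<rfloor>)"
  shows "(\<Sum>m = a..b. \<bar>of_int \<lceil>(real m - y) / \<alpha>\<rceil> - 1 / 2 - fejer_prim H ((real m - y) / \<alpha>)\<bar>) \<le>
    (\<alpha> * real K + 2) * \<alpha>\<^sup>2 / (real H * \<delta>\<^sup>2) +
    real (card {r \<in> {..<K + 2}. \<exists>m::int. \<bar>y + \<alpha> * real r - of_int m\<bar> \<le> \<delta>})"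
proof -
  define E where "E m = \<bar>of_int \<lceil>(real m - y) / \<alpha>\<rceil> - 1 / 2 - fejer_prim H ((real m - y) / \<alpha>)\<bar>" for m :: nat
  let ?near = "\<lambda>m::nat. \<exists>n::int. \<bar>(real m - y) / \<alpha> - of_int n\<bar> < \<delta> / \<alpha>"
  let ?B = "{r \<in> {..<K + 2}. \<exists>m::int. \<bar>y + \<alpha> * real r - of_int m\<bar> \<le> \<delta>}"
  have \<delta>\<alpha>: "0 < \<delta> / \<alpha>" "\<delta> / \<alpha> < 1"
    using assms by (auto simp: field_simps)
  have "\<alpha> * 1 \<le> \<alpha> * real K" using \<alpha> assms(6) by (intro mult_left_mono) auto
  then have "0 \<le> y + \<alpha> * real K" using assms(2) by linarith
  then have ab: "real a \<le> y + \<alpha>" "y + \<alpha> < real a + 1" "real b \<le> y + \<alpha> * real K + 1"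
    using real_nat_floor[OF assms(2)] real_nat_floor[of "y + \<alpha> * real K"] unfolding a_def b_def by auto
  have E: "E m \<le> \<alpha>\<^sup>2 / (real H * \<delta>\<^sup>2) + (if ?near m then 1 else 0)" for m
  proof (cases "?near m")
    case True
    have "E m \<le> 1 / 2" unfolding E_def by (rule ceiling_minus_fejer_prim_bound[OF \<open>0 < H\<close>])
    moreover have "0 \<le> \<alpha>\<^sup>2 / (real H * \<delta>\<^sup>2)" by simp
    ultimately have "E m \<le> \<alpha>\<^sup>2 / (real H * \<delta>\<^sup>2) + 1" by linarith
    then show ?thesis using True by (simp only: if_True)
  next
    case False
    then have "E m \<le> 1 / (real H * (\<delta> / \<alpha>)\<^sup>2)"
      unfolding E_def using \<delta>\<alpha> \<open>0 < H\<close> by (intro ceiling_minus_fejer_prim_small) (auto simp: not_less)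
    then show ?thesis using False by (simp add: power_divide)
  qed
  have near: "\<exists>r\<in>?B. \<bar>real m - (y + \<alpha> * real r)\<bar> < \<delta>" if m: "m \<in> {a..b}" "?near m" for m
  proof -
    from m obtain n :: int where n: "\<bar>(real m - y) / \<alpha> - of_int n\<bar> < \<delta> / \<alpha>" by auto
    have "\<alpha> * \<bar>(real m - y) / \<alpha> - of_int n\<bar> < \<alpha> * (\<delta> / \<alpha>)"
      using n \<alpha> by (intro mult_strict_left_mono) auto
    also have "\<alpha> * \<bar>(real m - y) / \<alpha> - of_int n\<bar> = \<bar>\<alpha> * ((real m - y) / \<alpha> - of_int n)\<bar>"
      using \<alpha> by (simp add: abs_mult)
    also have "\<alpha> * ((real m - y) / \<alpha> - of_int n) = real m - (y + \<alpha> * of_int n)"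
      using \<alpha> by (simp add: field_simps)
    finally have n': "\<bar>real m - (y + \<alpha> * of_int n)\<bar> < \<delta>" using \<alpha> by simp
    \<comment> \<open>From \<open>m \<ge> a > y + \<alpha> - 1\<close> and
      \<open>m \<le> b \<le> y + \<alpha> * K + 1\<close> it follows that \<open>n\<close> lies
      between 0 and \<open>K + 1\<close>; hence the range \<open>K + 2\<close> in the count.\<close>
    have "0 < (real m - y) / \<alpha>"
      using m ab \<alpha> by (intro divide_pos_pos) auto
    then have "- 1 < real_of_int n" using n \<delta>\<alpha> by linarith
    then have n0: "0 \<le> n" by linarith
    have "real m \<le> real b" using m by simp
    then have "real m - y \<le> \<alpha> * (real K + 1)" using ab \<alpha> by (simp add: distrib_left)
    then have "(real m - y) / \<alpha> \<le> real K + 1" using \<alpha> by (simp add: field_simps)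
    then have "real_of_int n < real K + 2" using n \<delta>\<alpha> by linarith
    then have nK: "n < int K + 2" by linarith
    show ?thesis
    proof (rule bexI[of _ "nat n"])
      show "\<bar>real m - (y + \<alpha> * real (nat n))\<bar> < \<delta>" using n' n0 by simp
      then have "\<bar>y + \<alpha> * real (nat n) - of_int (int m)\<bar> \<le> \<delta>" by simp
      moreover have "nat n < K + 2" using n0 nK by linarith
      ultimately show "nat n \<in> ?B" by blast
    qed
  qed
  \<comment> \<open>The assignment is injective: two integers within \<open>\<delta> < 1 / 2\<close>
    of the same point are equal.\<close>
  define g where "g m = (SOME r. r \<in> ?B \<and> \<bar>real m - (y + \<alpha> * real r)\<bar> < \<delta>)" for m :: nat
  have g: "g m \<in> ?B \<and> \<bar>real m - (y + \<alpha> * real (g m))\<bar> < \<delta>" if "m \<in> {a..b}" "?near m" for m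
    unfolding g_def by (rule someI_ex) (use near[OF that] in blast)
  have "card {m \<in> {a..b}. ?near m} \<le> card ?B"
  proof (rule card_inj_on_le[of g])
    show "inj_on g {m \<in> {a..b}. ?near m}"
    proof (rule inj_onI)
      fix m m' assume mm: "m \<in> {m \<in> {a..b}. ?near m}" "m' \<in> {m \<in> {a..b}. ?near m}" "g m = g m'"
      then have "\<bar>real m - (y + \<alpha> * real (g m))\<bar> < \<delta>" "\<bar>real m' - (y + \<alpha> * real (g m))\<bar> < \<delta>"
        using g[of m] g[of m'] by auto
      then have "\<bar>real m - real m'\<bar> < 1" using \<open>\<delta> < 1 / 2\<close> by linarith
      then show "m = m'" by linarith
    qed
  qed (use g in blast, simp)
  moreover have "sum E {a..b} \<le> (\<Sum>m = a..b. \<alpha>\<^sup>2 / (real H * \<delta>\<^sup>2) + (if ?near m then 1 else 0))"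
    by (intro sum_mono E)
  moreover have "(\<Sum>m = a..b. \<alpha>\<^sup>2 / (real H * \<delta>\<^sup>2) + (if ?near m then 1 else 0)) =
      real (card {a..b}) * (\<alpha>\<^sup>2 / (real H * \<delta>\<^sup>2)) + real (card {m \<in> {a..b}. ?near m})"
    by (simp add: sum.distrib sum.If_cases Int_def)
  moreover have "real (card {a..b}) * (\<alpha>\<^sup>2 / (real H * \<delta>\<^sup>2)) \<le> (\<alpha> * real K + 2) * (\<alpha>\<^sup>2 / (real H * \<delta>\<^sup>2))"
  proof (intro mult_right_mono)
    have "real (Suc b - a) \<le> \<alpha> * real K + 2"
      using ab \<alpha> \<open>\<alpha> * 1 \<le> \<alpha> * real K\<close> by (cases "a \<le> Suc b") (auto simp: of_nat_diff)
    then show "real (card {a..b}) \<le> \<alpha> * real K + 2" by simp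
  qed simp
  ultimately show ?thesis unfolding E_def by simp
qed

text \<open>Replacing \<open>F r\<close> by the line changes the integer part only where the line is
  within \<open>\<delta>\<close> of an integer, at a cost of 2 each. In the Beatty form of the
  remaining sum the ceiling is split into \<open>fejer_prim\<close> and the error \<open>E\<close>.
  Every \<open>E m\<close> with \<open>m\<close> in \<open>{a..b}\<close> occurs at most twice,
  which costs the count twice more.\<close>

lemma tm_near_line_sum_le:
  fixes F :: "nat \<Rightarrow> real"
  assumes \<alpha>: "1 < \<alpha>" and y: "0 \<le> y + \<alpha>" and "0 < H" "0 < \<delta>" "\<delta> < 1 / 2" and K: "1 \<le> K"
    and k: "\<alpha> * real K + 1 \<le> 2 ^ k"
    and F: "\<And>r. r \<in> {1..K} \<Longrightarrow> y + \<alpha> * real r \<le> F r \<and> F r \<le> y + \<alpha> * real r + \<delta>"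
  shows "\<bar>\<Sum>r = 1..K. tm (nat \<lfloor>F r\<rfloor>)\<bar> \<le>
    2 / \<alpha> + (\<Sum>h = 1..<H. min (1 / real h) (2 / \<alpha>) * tm_major k (real h / \<alpha>)) +
    2 * ((\<alpha> * real K + 2) * \<alpha>\<^sup>2 / (real H * \<delta>\<^sup>2)) +
    4 * real (card {r \<in> {..<K + 2}. \<exists>m::int. \<bar>y + \<alpha> * real r - of_int m\<bar> \<le> \<delta>})"
proof -
  define a where "a = nat \<lfloor>y + \<alpha>\<rfloor>"
  define b where "b = Suc (nat \<lfloor>y + \<alpha> * real K\<rfloor>)"
  let ?B = "{r \<in> {..<K + 2}. \<exists>m::int. \<bar>y + \<alpha> * real r - of_int m\<bar> \<le> \<delta>}"
  let ?Y = "\<lambda>m. (real m - y) / \<alpha>"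
  define E where "E m = of_int \<lceil>?Y m\<rceil> - 1 / 2 - fejer_prim H (?Y m)" for m :: nat
  define l where "l r = y + \<alpha> * real r" for r :: nat
  have "\<alpha> * 1 \<le> \<alpha> * real K" using \<alpha> K by (intro mult_left_mono) auto
  then have "0 \<le> y + \<alpha> * real K" using y by linarith
  then have ab: "real a \<le> y + \<alpha>" "y + \<alpha> < real a + 1" "real b \<le> y + \<alpha> * real K + 1"
    using real_nat_floor[OF y] real_nat_floor[of "y + \<alpha> * real K"] unfolding a_def b_def by auto
  have "real b \<le> real (a + 2 ^ k)" using ab k \<alpha> by simp
  then have bk: "b \<le> a + 2 ^ k" by (simp only: of_nat_le_iff)
  have 1: "\<bar>tm (nat \<lfloor>F r\<rfloor>) - tm (nat \<lfloor>l r\<rfloor>)\<bar> \<le> (if r \<in> ?B then 2 else 0)" if r: "r \<in> {1..K}" for r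
  proof (cases "\<lfloor>F r\<rfloor> = \<lfloor>l r\<rfloor>")
    case False
    have Fr: "l r \<le> F r" "F r \<le> l r + \<delta>" using F[OF r] by (auto simp: l_def)
    with False have "\<lfloor>l r\<rfloor> < \<lfloor>F r\<rfloor>" using floor_mono[OF Fr(1)] by simp
    then have "l r \<le> of_int \<lfloor>F r\<rfloor>" by linarith
    moreover have "of_int \<lfloor>F r\<rfloor> \<le> l r + \<delta>" using Fr(2) by linarith
    ultimately have "\<bar>l r - of_int \<lfloor>F r\<rfloor>\<bar> \<le> \<delta>" by linarith
    then have "r \<in> ?B" using r by (auto simp: l_def)
    moreover have "\<bar>tm (nat \<lfloor>F r\<rfloor>) - tm (nat \<lfloor>l r\<rfloor>)\<bar> \<le> 2"
      using abs_triangle_ineq4[of "tm (nat \<lfloor>F r\<rfloor>)" "tm (nat \<lfloor>l r\<rfloor>)"] by simp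
    ultimately show ?thesis by simp
  qed simp
  have "\<bar>(\<Sum>r = 1..K. tm (nat \<lfloor>F r\<rfloor>)) - (\<Sum>r = 1..K. tm (nat \<lfloor>l r\<rfloor>))\<bar> \<le>
      (\<Sum>r = 1..K. if r \<in> ?B then 2 else 0)"
    unfolding sum_subtractf[symmetric] by (rule order_trans[OF sum_abs sum_mono]) (rule 1)
  also have "\<dots> = (\<Sum>r\<in>{1..K} \<inter> ?B. 2)" by (rule sum.inter_restrict[symmetric]) simp
  also have "\<dots> \<le> (\<Sum>r\<in>?B. 2)" by (intro sum_mono2) auto
  also have "\<dots> = 2 * real (card ?B)" by simp
  finally have diff: "\<bar>(\<Sum>r = 1..K. tm (nat \<lfloor>F r\<rfloor>)) - (\<Sum>r = 1..K. tm (nat \<lfloor>l r\<rfloor>))\<bar> \<le> 2 * real (card ?B)" .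
  have "(\<Sum>r = 1..K. tm (nat \<lfloor>l r\<rfloor>)) = (\<Sum>m = a..<b. tm m * of_int (\<lceil>?Y (Suc m)\<rceil> - \<lceil>?Y m\<rceil>))"
    unfolding l_def a_def b_def by (rule sum_beatty_eq[OF \<alpha> y K])
  also have "\<dots> = (\<Sum>m = a..<b. tm m * (fejer_prim H (?Y (Suc m)) - fejer_prim H (?Y m))) +
      (\<Sum>m = a..<b. tm m * (E (Suc m) - E m))"
    unfolding sum.distrib[symmetric] E_def by (intro sum.cong refl) (simp add: algebra_simps)
  finally have main: "(\<Sum>r = 1..K. tm (nat \<lfloor>l r\<rfloor>)) =
      (\<Sum>m = a..<b. tm m * (fejer_prim H (?Y (Suc m)) - fejer_prim H (?Y m))) +
      (\<Sum>m = a..<b. tm m * (E (Suc m) - E m))" .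
  have "\<bar>\<Sum>m = a..<b. tm m * (E (Suc m) - E m)\<bar> \<le> (\<Sum>m = a..<b. \<bar>E (Suc m)\<bar> + \<bar>E m\<bar>)"
    by (rule order_trans[OF sum_abs sum_mono]) (simp add: abs_mult abs_triangle_ineq4)
  also have "\<dots> = (\<Sum>m = Suc a..<Suc b. \<bar>E m\<bar>) + (\<Sum>m = a..<b. \<bar>E m\<bar>)"
    unfolding sum.distrib sum.shift_bounds_Suc_ivl ..
  also have "\<dots> \<le> (\<Sum>m = a..b. \<bar>E m\<bar>) + (\<Sum>m = a..b. \<bar>E m\<bar>)"
    by (intro add_mono sum_mono2) auto
  also have "\<dots> \<le> 2 * ((\<alpha> * real K + 2) * \<alpha>\<^sup>2 / (real H * \<delta>\<^sup>2) + real (card ?B))"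
    using sum_sawtooth_error_le[OF \<alpha> y \<open>0 < H\<close> \<open>0 < \<delta>\<close> \<open>\<delta> < 1 / 2\<close> K]
    unfolding E_def a_def b_def by simp
  finally have err: "\<bar>\<Sum>m = a..<b. tm m * (E (Suc m) - E m)\<bar> \<le>
      2 * ((\<alpha> * real K + 2) * \<alpha>\<^sup>2 / (real H * \<delta>\<^sup>2) + real (card ?B))" .
  have "0 < \<alpha>" using \<alpha> by simp
  note sum_tm_fejer_prim_le[OF this bk, of H y]
  with err diff main show ?thesis unfolding distrib_left by linarith
qed

section \<open>Averaging over the slope\<close>

text \<open>Taylor expansion to second order, by applying the mean value theorem twice. The
  remainder uses \<open>c * (c - 1) \<le> 2\<close>, and \<open>w powr (c - 2)\<close> is largest at
  the left end because the exponent is negative.\<close>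

lemma powr_tangent:
  fixes c x n A d :: real
  assumes c: "1 < c" "c < 2" and "0 < A" "A \<le> x" "x \<le> n" "n - x \<le> d"
  shows "x powr c + c * x powr (c - 1) * (n - x) \<le> n powr c"
    and "n powr c \<le> x powr c + c * x powr (c - 1) * (n - x) + 2 * d\<^sup>2 * A powr (c - 2)"
proof -
  have "\<exists>s. 0 \<le> s \<and> s \<le> 2 * d * A powr (c - 2) \<and> n powr c = x powr c + (n - x) * (c * x powr (c - 1) + s)"
  proof (cases "x = n")
    case False
    then have "x < n" using assms by simp
    have der: "((\<lambda>t. t powr p) has_real_derivative p * t powr (p - 1)) (at t)" if "x \<le> t" for t p
      using that assms by (intro has_real_derivative_powr) auto
    from \<open>x < n\<close> obtain z where z: "x < z" "z < n" "n powr c - x powr c = (n - x) * (c * z powr (c - 1))"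
      using MVT2[of x n "\<lambda>t. t powr c" "\<lambda>t. c * t powr (c - 1)"] der by blast
    have "\<exists>w. x < w \<and> w < z \<and> z powr (c - 1) - x powr (c - 1) = (z - x) * ((c - 1) * w powr (c - 1 - 1))"
      using MVT2[of x z "\<lambda>t. t powr (c - 1)" "\<lambda>t. (c - 1) * t powr (c - 1 - 1)"] der z(1) by blast
    then obtain w where w: "x < w" "w < z" "z powr (c - 1) - x powr (c - 1) = (z - x) * ((c - 1) * w powr (c - 1 - 1))"
      by blast
    define s where "s = c * (z powr (c - 1) - x powr (c - 1))"
    have s: "s = c * (c - 1) * (z - x) * w powr (c - 2)"
      unfolding s_def w(3) by (simp add: mult_ac)
    have "s \<ge> 0" unfolding s using c w z by (intro mult_nonneg_nonneg) auto
    moreover have "s \<le> 2 * d * A powr (c - 2)"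
      unfolding s
    proof (rule mult_mono)
      have "c * (c - 1) \<le> 2 * 1" using c by (intro mult_mono) auto
      then show "c * (c - 1) * (z - x) \<le> 2 * d"
        using assms z c by (intro mult_mono) auto
      show "w powr (c - 2) \<le> A powr (c - 2)"
        using c w assms by (intro powr_mono2') auto
    qed (use assms in auto)
    moreover have "n powr c = x powr c + (n - x) * (c * x powr (c - 1) + s)"
      using z(3) by (simp add: s_def algebra_simps)
    ultimately show ?thesis by blast
  qed (use assms in auto)
  then obtain s where s: "0 \<le> s" "s \<le> 2 * d * A powr (c - 2)"
      "n powr c = x powr c + (n - x) * (c * x powr (c - 1) + s)" by blast
  have "0 \<le> (n - x) * s" using s assms by simp
  then show "x powr c + c * x powr (c - 1) * (n - x) \<le> n powr c"
    unfolding s(3) by (simp add: algebra_simps)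
  have "(n - x) * s \<le> d * (2 * d * A powr (c - 2))"
    using s assms by (intro mult_mono) auto
  then show "n powr c \<le> x powr c + c * x powr (c - 1) * (n - x) + 2 * d\<^sup>2 * A powr (c - 2)"
    unfolding s(3) by (simp add: algebra_simps power2_eq_square)
qed

lemma powr_slope_bounds:
  fixes c x A :: real
  assumes c: "1 < c" "c < 2" and A: "1 \<le> A" "A \<le> x" "x \<le> 2 * A"
  shows "1 < c * x powr (c - 1)" "A powr (c - 1) \<le> c * x powr (c - 1)"
    "c * x powr (c - 1) \<le> 4 * A powr (c - 1)"
proof -
  have 1: "1 \<le> A powr (c - 1)" using A c by (intro ge_one_powr_ge_zero) auto
  have 2: "A powr (c - 1) \<le> x powr (c - 1)" using A c by (intro powr_mono2) auto
  have "1 * x powr (c - 1) < c * x powr (c - 1)" using 1 2 c by (intro mult_strict_right_mono) auto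
  then show "1 < c * x powr (c - 1)" "A powr (c - 1) \<le> c * x powr (c - 1)" using 1 2 by linarith+
  have "x powr (c - 1) \<le> (2 * A) powr (c - 1)" using A c by (intro powr_mono2) auto
  also have "\<dots> = 2 powr (c - 1) * A powr (c - 1)" using A by (simp add: powr_mult)
  also have "\<dots> \<le> 2 powr 1 * A powr (c - 1)" using c by (intro mult_right_mono powr_mono) auto
  finally have "x powr (c - 1) \<le> 2 * A powr (c - 1)" by simp
  then have "c * x powr (c - 1) \<le> 2 * (2 * A powr (c - 1))" using c by (intro mult_mono) auto
  then show "c * x powr (c - 1) \<le> 4 * A powr (c - 1)" by simp
qed

text \<open>In \<open>window_bound\<close>, the parameter \<open>D\<close> is the order of magnitude of the slope
  \<open>\<alpha> = c * x powr (c - 1)\<close>, and the argument of \<open>tm_major\<close> is \<open>- h / \<alpha>\<close>, whose sign makes it an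
  increasing function of \<open>x\<close>.\<close>

definition window_bound :: "real \<Rightarrow> nat \<Rightarrow> nat \<Rightarrow> nat \<Rightarrow> nat \<Rightarrow> real \<Rightarrow> real \<Rightarrow> real \<Rightarrow> real" where
  "window_bound D K H R k \<delta> c x =
     2 + (\<Sum>h = 1..<H. min (1 / real h) (2 / D) * tm_major k (- real h / c * x powr (1 - c))) +
     2 * ((4 * D * real K + 2) * (4 * D)\<^sup>2 / (real H * \<delta>\<^sup>2)) +
     32 / (real R)\<^sup>2 * (\<Sum>p<R. \<Sum>q<R. fejer (2 * (K + 2)) ((real p - real q) * c * x powr (c - 1)))"

text \<open>The point of tangency \<open>x\<close> is free in \<open>[j, j + 1]\<close>, while the
  window sum does not involve it. Since \<open>r \<ge> 1\<close>, the points \<open>j + r\<close>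
  lie to the right of \<open>x\<close>, and by convexity the curve lies above the tangent, as the
  comparison with a line demands.\<close>

lemma tm_window_le:
  fixes c x :: real and N K H R j k :: nat
  assumes c: "1 < c" "c < 2" and N: "1 \<le> N" "N \<le> j" "j < 2 * N" and x: "real j \<le> x" "x \<le> real j + 1"
    and K: "1 \<le> K" and "0 < H" "0 < R"
  defines "D \<equiv> real N powr (c - 1)" and "\<delta> \<equiv> 2 * (real K)\<^sup>2 * real N powr (c - 2)"
  assumes R: "6 * real R * \<delta> \<le> 1" and k: "4 * D * real K + 1 \<le> 2 ^ k"
  shows "\<bar>\<Sum>r = 1..K. tm (nat \<lfloor>real (j + r) powr c\<rfloor>)\<bar> \<le> window_bound D K H R k \<delta> c x"
proof -
  define \<alpha> where "\<alpha> = c * x powr (c - 1)"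
  define y where "y = x powr c + \<alpha> * (real j - x)"
  have xN: "real N \<le> x" "x \<le> 2 * real N"
    using N x by linarith+
  have \<alpha>: "1 < \<alpha>" "D \<le> \<alpha>" "\<alpha> \<le> 4 * D"
    unfolding \<alpha>_def D_def using powr_slope_bounds[OF c _ xN] N by auto
  have D: "1 \<le> D" unfolding D_def using N c by (intro ge_one_powr_ge_zero) auto
  have \<delta>: "0 < \<delta>" unfolding \<delta>_def using K N by simp
  have "6 * 1 * \<delta> \<le> 6 * real R * \<delta>" using \<open>0 < R\<close> \<delta> by (intro mult_right_mono) auto
  then have \<delta>2: "\<delta> < 1 / 2" using R by linarith
  \<comment> \<open>This is the height of the tangent at \<open>j + 1\<close>, the first point of
    the window.\<close>
  have "0 \<le> x powr c + \<alpha> * (real j + 1 - x)"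
    using x \<alpha> by (intro add_nonneg_nonneg mult_nonneg_nonneg) auto
  then have y: "0 \<le> y + \<alpha>" by (simp add: y_def algebra_simps)
  have "\<alpha> * real K \<le> 4 * D * real K" using \<alpha> by (intro mult_right_mono) auto
  then have k': "\<alpha> * real K + 1 \<le> 2 ^ k" using k by linarith
  have F: "y + \<alpha> * real r \<le> real (j + r) powr c \<and> real (j + r) powr c \<le> y + \<alpha> * real r + \<delta>"
    if r: "r \<in> {1..K}" for r
  proof -
    have "x \<le> real (j + r)" "real (j + r) - x \<le> real K" using r x by auto
    from powr_tangent[OF c _ xN(1) this] N
    show ?thesis unfolding y_def \<alpha>_def \<delta>_def by (simp add: algebra_simps)
  qed
  define B where "B = {r \<in> {..<K + 2}. \<exists>m::int. \<bar>y + \<alpha> * real r - of_int m\<bar> \<le> \<delta>}"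
  have "\<bar>\<Sum>r = 1..K. tm (nat \<lfloor>real (j + r) powr c\<rfloor>)\<bar> \<le>
    2 / \<alpha> + (\<Sum>h = 1..<H. min (1 / real h) (2 / \<alpha>) * tm_major k (real h / \<alpha>)) +
    2 * ((\<alpha> * real K + 2) * \<alpha>\<^sup>2 / (real H * \<delta>\<^sup>2)) + 4 * real (card B)"
    unfolding B_def by (rule tm_near_line_sum_le[OF \<alpha>(1) y \<open>0 < H\<close> \<delta> \<delta>2 K k' F])
  moreover have "2 / \<alpha> \<le> 2" using \<alpha> by (simp add: field_simps)
  moreover have "(\<Sum>h = 1..<H. min (1 / real h) (2 / \<alpha>) * tm_major k (real h / \<alpha>)) \<le>
      (\<Sum>h = 1..<H. min (1 / real h) (2 / D) * tm_major k (- real h / c * x powr (1 - c)))"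
  proof (rule sum_mono)
    fix h
    have "x powr (1 - c) = 1 / x powr (c - 1)"
      using powr_minus_divide[of x "c - 1"] by simp
    then have "- real h / c * x powr (1 - c) = - (real h / \<alpha>)" by (simp add: \<alpha>_def)
    moreover have "2 / \<alpha> \<le> 2 / D" using \<alpha> D by (intro divide_left_mono) auto
    ultimately show "min (1 / real h) (2 / \<alpha>) * tm_major k (real h / \<alpha>) \<le>
        min (1 / real h) (2 / D) * tm_major k (- real h / c * x powr (1 - c))"
      by (simp only: tm_major_minus) (intro mult_right_mono min.mono tm_major_nonneg order_refl)
  qed
  moreover have "(\<alpha> * real K + 2) * \<alpha>\<^sup>2 / (real H * \<delta>\<^sup>2) \<le> (4 * D * real K + 2) * (4 * D)\<^sup>2 / (real H * \<delta>\<^sup>2)"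
    using \<alpha> D by (intro divide_right_mono mult_mono power_mono add_mono) auto
  moreover have "real (card B) \<le> 8 / (real R)\<^sup>2 *
      (\<Sum>p<R. \<Sum>q<R. fejer (2 * (K + 2)) ((real p - real q) * c * x powr (c - 1)))"
    using card_near_int_le[OF \<open>0 < R\<close> R, of "K + 2" y \<alpha>] by (simp add: B_def \<alpha>_def mult.assoc)
  ultimately show ?thesis unfolding window_bound_def by simp
qed

section \<open>Mean values over the point of tangency\<close>

text \<open>As \<open>x\<close> runs through \<open>[N, 2 * N]\<close> the frequency increases with
  speed at least \<open>\<mu>\<close> over a range of length at most \<open>h / D\<close>, so it
  sweeps at most \<open>h / D + 2\<close> periods. The constant is 520 = 5 * 8 * 13.\<close>

lemma integral_tm_major_slope_le:
  fixes c :: real and N h :: nat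
  assumes c: "1 < c" "c < 2" and N: "1 \<le> N" and h: "1 \<le> h"
  defines "D \<equiv> real N powr (c - 1)"
  shows "min (1 / real h) (2 / D) *
      integral {real N..2 * real N} (\<lambda>x. tm_major k (- real h / c * x powr (1 - c)))
    \<le> 520 / (c - 1) * real N * (53/40) ^ k / real h"
proof -
  let ?g = "\<lambda>x. - real h / c * x powr (1 - c)"
  let ?g' = "\<lambda>x. - real h / c * ((1 - c) * x powr (1 - c - 1))"
  \<comment> \<open>The derivative is \<open>h * (c - 1) / c * x powr (- c)\<close>; the bounds
    \<open>c < 2\<close> and \<open>x \<le> 2 * N\<close> give \<open>1 / c \<ge> 1 / 2\<close> and
    \<open>x powr (- c) \<ge> 1 / (4 * N powr c)\<close>.\<close>
  define \<mu> where "\<mu> = real h * (c - 1) / (8 * real N powr c)"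
  have N0: "0 < real N" using N by simp
  have D: "1 \<le> D" unfolding D_def using N c by (intro ge_one_powr_ge_zero) auto
  have \<mu>0: "0 < \<mu>" unfolding \<mu>_def using h c N by simp
  have "integral {real N..2 * real N} (\<lambda>x. tm_major k (?g x)) \<le>
      (?g (2 * real N) - ?g (real N) + 2) / \<mu> * integral {0..1} (tm_major k)"
  proof (rule integral_periodic_compose_le[where g' = ?g'])
    show "continuous_on UNIV (tm_major k)" by (rule continuous_on_tm_major[OF continuous_on_id])
    fix x assume x: "x \<in> {real N..2 * real N}"
    then have x0: "0 < x" using N0 by auto
    then show "(?g has_real_derivative ?g' x) (at x)"
      by (intro DERIV_cmult has_real_derivative_powr)
    have "real N powr c * x powr (- c) = (real N / x) powr c"
      using x0 N0 by (simp add: powr_minus_divide powr_divide)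
    moreover have "(1 / 2) powr 2 \<le> (1 / 2 :: real) powr c" using c by (intro powr_mono') auto
    moreover have "(1 / 2) powr c \<le> (real N / x) powr c"
      using x x0 c by (intro powr_mono2) (auto simp: field_simps)
    moreover have "(1 / 2 :: real) powr 2 = 1 / 4" by (simp add: power2_eq_square)
    ultimately have "1 / 4 \<le> real N powr c * x powr (- c)" by linarith
    then have "1 / (4 * real N powr c) \<le> x powr (- c)" using N0 by (simp add: field_simps)
    then have "real h / 2 * (c - 1) * (1 / (4 * real N powr c)) \<le> real h / c * (c - 1) * x powr (- c)"
      using c by (intro mult_mono divide_left_mono) auto
    moreover have "?g' x = real h / c * (c - 1) * x powr (- c)"
    proof -
      have "- a * ((1 - c) * b) = a * (c - 1) * b" for a b :: real by (simp add: algebra_simps)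
      from this[of "real h / c"] show ?thesis by simp
    qed
    moreover have "\<mu> = real h / 2 * (c - 1) * (1 / (4 * real N powr c))" by (simp add: \<mu>_def)
    ultimately show "\<mu> \<le> ?g' x" by (simp only:)
  qed (use N0 \<mu>0 in \<open>auto simp: tm_major_plus_1 tm_major_nonneg\<close>)
  also have "\<dots> \<le> (real h / D + 2) / \<mu> * (13 * (53/40) ^ k)"
  proof (intro mult_mono integral_tm_major_le divide_right_mono)
    have "?g (2 * real N) \<le> 0" using c by (simp add: divide_nonneg_nonneg)
    moreover have "- ?g (real N) \<le> real h / D"
    proof -
      have "real N powr (1 - c) = 1 / D" using powr_minus_divide[of "real N" "c - 1"] by (simp add: D_def)
      then have "- ?g (real N) = real h / D / c" by simp
      also have "\<dots> \<le> real h / D / 1" using c D by (intro divide_left_mono) auto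
      finally show ?thesis by simp
    qed
    ultimately show "?g (2 * real N) - ?g (real N) + 2 \<le> real h / D + 2" by linarith
    show "0 \<le> integral {0..1} (tm_major k)"
      by (intro integral_nonneg integrable_continuous_real continuous_on_tm_major[OF continuous_on_id] tm_major_nonneg)
  qed (use D \<mu>0 in auto)
  finally have I: "integral {real N..2 * real N} (\<lambda>x. tm_major k (?g x)) \<le>
      (real h / D + 2) / \<mu> * (13 * (53/40) ^ k)" .
  \<comment> \<open>The entry \<open>1 / h\<close> of the minimum is used against the full periods
    \<open>h / D\<close>, the entry \<open>2 / D\<close> against the 2 for incomplete
    periods.\<close>
  have m: "min (1 / real h) (2 / D) * (real h / D + 2) \<le> 5 / D"
  proof -
    have "min (1 / real h) (2 / D) * (real h / D) \<le> 1 / real h * (real h / D)"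
      using D by (intro mult_right_mono) auto
    moreover have "min (1 / real h) (2 / D) * 2 \<le> 2 / D * 2" by (intro mult_right_mono) auto
    ultimately show ?thesis using h by (simp add: distrib_left)
  qed
  have "min (1 / real h) (2 / D) * integral {real N..2 * real N} (\<lambda>x. tm_major k (?g x)) \<le>
      min (1 / real h) (2 / D) * ((real h / D + 2) / \<mu> * (13 * (53/40) ^ k))"
    using D by (intro mult_left_mono I) auto
  also have "\<dots> = (min (1 / real h) (2 / D) * (real h / D + 2)) * (13 * (53/40) ^ k / \<mu>)" by simp
  also have "\<dots> \<le> 5 / D * (13 * (53/40) ^ k / \<mu>)" using \<mu>0 by (intro mult_right_mono m) auto
  also have "\<dots> = 520 / (c - 1) * (real N powr c / D) * (53/40) ^ k / real h"
    by (simp add: \<mu>_def mult_ac)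
  also have "real N powr c / D = real N" using N0 by (simp add: D_def powr_diff)
  finally show ?thesis .
qed

text \<open>The same sweeping argument for the argument \<open>d * c * x powr (c - 1)\<close>, with
  evenness of the kernel reducing to positive \<open>d\<close>. The kernel has mean 1 and faster
  motion for larger \<open>d\<close> is matched by a longer range, so the bound depends on neither
  \<open>d\<close> nor \<open>Q\<close>.\<close>

lemma integral_fejer_slope_le:
  fixes c d :: real and N Q :: nat
  assumes c: "1 < c" "c < 2" and N: "1 \<le> N" and d: "1 \<le> \<bar>d\<bar>" and Q: "0 < Q"
  shows "integral {real N..2 * real N} (\<lambda>x. fejer Q (d * c * x powr (c - 1))) \<le> 12 / (c - 1) * real N"
proof -
  define e where "e = \<bar>d\<bar>"
  let ?g = "\<lambda>x. e * c * x powr (c - 1)"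
  let ?g' = "\<lambda>x. e * c * ((c - 1) * x powr (c - 1 - 1))"
  define D where "D = real N powr (c - 1)"
  \<comment> \<open>Here \<open>c \<ge> 1\<close> and \<open>x powr (c - 2) \<ge> (2 * N) powr (c -
    2) \<ge> N powr (c - 2) / 2\<close> bound the derivative from below.\<close>
  define \<mu> where "\<mu> = e * (c - 1) * real N powr (c - 2) / 2"
  have N0: "0 < real N" using N by simp
  have e: "1 \<le> e" using d by (simp add: e_def)
  have D: "1 \<le> D" unfolding D_def using N c by (intro ge_one_powr_ge_zero) auto
  have \<mu>0: "0 < \<mu>" unfolding \<mu>_def using e c N by simp
  have "fejer Q (d * c * x powr (c - 1)) = fejer Q (?g x)" for x
    using fejer_minus[of Q "d * c * x powr (c - 1)"] by (cases "d \<ge> 0") (auto simp: e_def)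
  then have "integral {real N..2 * real N} (\<lambda>x. fejer Q (d * c * x powr (c - 1))) =
      integral {real N..2 * real N} (\<lambda>x. fejer Q (?g x))" by simp
  also have "\<dots> \<le> (?g (2 * real N) - ?g (real N) + 2) / \<mu> * integral {0..1} (fejer Q)"
  proof (rule integral_periodic_compose_le[where g' = ?g'])
    show "continuous_on UNIV (fejer Q)" by (rule continuous_on_fejer[OF continuous_on_id])
    show "fejer Q (x + 1) = fejer Q x" for x using fejer_add_int[of Q x 1] by simp
    fix x assume x: "x \<in> {real N..2 * real N}"
    then have x0: "0 < x" using N0 by auto
    then show "(?g has_real_derivative ?g' x) (at x)"
      by (intro DERIV_cmult has_real_derivative_powr)
    have "(2 * real N) powr (c - 2) \<le> x powr (c - 2)" using x x0 c by (intro powr_mono2') auto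
    moreover have "(2 * real N) powr (c - 2) = 2 powr (c - 2) * real N powr (c - 2)"
      using N0 by (simp add: powr_mult)
    moreover have "2 powr (- 1) * real N powr (c - 2) \<le> 2 powr (c - 2) * real N powr (c - 2)"
      using c by (intro mult_right_mono powr_mono) auto
    moreover have "2 powr (- 1 :: real) = 1 / 2" by (simp add: powr_minus_divide)
    ultimately have "real N powr (c - 2) / 2 \<le> x powr (c - 2)" by simp
    then have "e * 1 * ((c - 1) * (real N powr (c - 2) / 2)) \<le> e * c * ((c - 1) * x powr (c - 2))"
      using c e by (intro mult_mono) auto
    then show "\<mu> \<le> ?g' x" by (simp add: \<mu>_def)
  qed (use N0 \<mu>0 fejer_nonneg in auto)
  also have "\<dots> \<le> 6 * e * D / \<mu>"
  proof -
    have "c * (2 * real N) powr (c - 1) \<le> 4 * D"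
      unfolding D_def using N by (intro powr_slope_bounds[OF c]) auto
    then have "e * (c * (2 * real N) powr (c - 1)) \<le> e * (4 * D)" using e by (intro mult_left_mono) auto
    moreover have "0 \<le> ?g (real N)" using e c by simp
    moreover have "1 * 1 \<le> e * D" using e D by (intro mult_mono) auto
    ultimately have "?g (2 * real N) - ?g (real N) + 2 \<le> 6 * e * D" by (simp add: mult.assoc)
    then show ?thesis unfolding integral_fejer[OF Q] using \<mu>0 by (simp add: divide_right_mono)
  qed
  also have "\<dots> = 12 / (c - 1) * (D / real N powr (c - 2))"
    using e by (simp add: \<mu>_def)
  also have "D / real N powr (c - 2) = real N powr 1"
    unfolding D_def by (simp flip: powr_diff)
  finally show ?thesis using N0 by simp
qed

lemma continuous_on_powr_const:
  fixes A B p :: real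
  assumes "0 < A"
  shows "continuous_on {A..B} (\<lambda>x. x powr p)"
  using assms by (intro continuous_intros) auto

text \<open>Termwise integration. In the double sum the \<open>R\<close> diagonal pairs each
  contribute the peak value \<open>fejer Q 0 = Q\<close> times \<open>N\<close>, and every other
  pair only a constant times \<open>N\<close>; after division by \<open>R^2\<close> this leaves
  \<open>Q / R\<close> and a constant.\<close>

lemma integral_window_bound_le:
  fixes c \<delta> :: real and N K H R k :: nat
  assumes c: "1 < c" "c < 2" and N: "1 \<le> N" and R: "0 < R"
  defines "D \<equiv> real N powr (c - 1)"
  shows "integral {real N..2 * real N} (window_bound D K H R k \<delta> c) \<le>
    real N * (2 + 520 / (c - 1) * (53/40) ^ k * (\<Sum>h = 1..<H. 1 / real h) +
      2 * ((4 * D * real K + 2) * (4 * D)\<^sup>2 / (real H * \<delta>\<^sup>2)) +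
      32 * (2 * (real K + 2) / real R + 12 / (c - 1)))"
proof -
  let ?I = "{real N..2 * real N}"
  define Q where "Q = 2 * (K + 2)"
  let ?t = "\<lambda>h x. tm_major k (- real h / c * x powr (1 - c))"
  let ?f = "\<lambda>p q x. fejer Q ((real p - real q) * c * x powr (c - 1))"
  let ?C = "2 * ((4 * D * real K + 2) * (4 * D)\<^sup>2 / (real H * \<delta>\<^sup>2))"
  have N0: "0 < real N" using N by simp
  note cp = continuous_on_powr_const[OF N0]
  have it: "?t h integrable_on ?I" for h
    by (intro integrable_continuous_real continuous_on_tm_major continuous_on_mult cp continuous_on_const)
  have iff: "?f p q integrable_on ?I" for p q
    by (intro integrable_continuous_real continuous_on_fejer continuous_on_mult cp continuous_on_const)
  have i1: "(\<lambda>x. \<Sum>h = 1..<H. min (1 / real h) (2 / D) * ?t h x) integrable_on ?I"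
    by (intro integrable_sum integrable_on_mult_right it) auto
  have i2: "(\<lambda>x. 32 / (real R)\<^sup>2 * (\<Sum>p<R. \<Sum>q<R. ?f p q x)) integrable_on ?I"
    by (intro integrable_on_mult_right integrable_sum iff) auto
  have "integral ?I (window_bound D K H R k \<delta> c) =
      integral ?I (\<lambda>x. (2 + ?C) + (\<Sum>h = 1..<H. min (1 / real h) (2 / D) * ?t h x) +
        32 / (real R)\<^sup>2 * (\<Sum>p<R. \<Sum>q<R. ?f p q x))"
    by (rule integral_cong) (simp add: window_bound_def Q_def)
  also have "\<dots> = integral ?I (\<lambda>x. 2 + ?C) + integral ?I (\<lambda>x. \<Sum>h = 1..<H. min (1 / real h) (2 / D) * ?t h x) +
        integral ?I (\<lambda>x. 32 / (real R)\<^sup>2 * (\<Sum>p<R. \<Sum>q<R. ?f p q x))"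
    by (subst integral_add[OF integrable_add[OF integrable_const_ivl i1] i2],
        subst integral_add[OF integrable_const_ivl i1]) (rule refl)
  finally have split: "integral ?I (window_bound D K H R k \<delta> c) =
      integral ?I (\<lambda>x. 2 + ?C) + integral ?I (\<lambda>x. \<Sum>h = 1..<H. min (1 / real h) (2 / D) * ?t h x) +
      integral ?I (\<lambda>x. 32 / (real R)\<^sup>2 * (\<Sum>p<R. \<Sum>q<R. ?f p q x))" .
  have 1: "integral ?I (\<lambda>x. 2 + ?C) = real N * (2 + ?C)" using N0 by simp
  have "integral ?I (\<lambda>x. \<Sum>h = 1..<H. min (1 / real h) (2 / D) * ?t h x) =
      (\<Sum>h = 1..<H. min (1 / real h) (2 / D) * integral ?I (?t h))"
    by (subst integral_sum) (simp_all only: finite_atLeastLessThan integral_mult_right integrable_on_mult_right[OF it])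
  also have "\<dots> \<le> (\<Sum>h = 1..<H. 520 / (c - 1) * real N * (53/40) ^ k / real h)"
    unfolding D_def by (intro sum_mono integral_tm_major_slope_le c N) auto
  also have "\<dots> = real N * (520 / (c - 1) * (53/40) ^ k * (\<Sum>h = 1..<H. 1 / real h))"
    unfolding sum_distrib_left by (intro sum.cong refl) simp
  finally have 2: "integral ?I (\<lambda>x. \<Sum>h = 1..<H. min (1 / real h) (2 / D) * ?t h x) \<le>
      real N * (520 / (c - 1) * (53/40) ^ k * (\<Sum>h = 1..<H. 1 / real h))" .
  have "integral ?I (\<lambda>x. \<Sum>p<R. \<Sum>q<R. ?f p q x) = (\<Sum>p<R. \<Sum>q<R. integral ?I (?f p q))"
    by (simp add: integral_sum integrable_sum iff)
  also have "\<dots> \<le> (\<Sum>p<R. \<Sum>q<R. (if p = q then real N * real Q else 0) + 12 / (c - 1) * real N)"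
  proof (intro sum_mono)
    fix p q
    show "integral ?I (?f p q) \<le> (if p = q then real N * real Q else 0) + 12 / (c - 1) * real N"
    proof (cases "p = q")
      case True
      have "fejer Q 0 = real Q" by (simp add: fejer_def power2_eq_square)
      then show ?thesis using True N0 c by simp
    next
      case False
      then have "1 \<le> \<bar>real p - real q\<bar>" by linarith
      from integral_fejer_slope_le[OF c N this, of Q] False show ?thesis by (simp add: Q_def)
    qed
  qed
  also have "\<dots> = real R * (real N * real Q) + (real R)\<^sup>2 * (12 / (c - 1) * real N)"
    by (simp add: sum.distrib power2_eq_square distrib_left)
  finally have "32 / (real R)\<^sup>2 * integral ?I (\<lambda>x. \<Sum>p<R. \<Sum>q<R. ?f p q x) \<le>
      32 / (real R)\<^sup>2 * (real R * (real N * real Q) + (real R)\<^sup>2 * (12 / (c - 1) * real N))"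
    by (intro mult_left_mono) auto
  also have "\<dots> = real N * (32 * (2 * (real K + 2) / real R + 12 / (c - 1)))"
    using R c by (simp add: Q_def field_simps power2_eq_square)
  finally have 3: "integral ?I (\<lambda>x. 32 / (real R)\<^sup>2 * (\<Sum>p<R. \<Sum>q<R. ?f p q x)) \<le>
      real N * (32 * (2 * (real K + 2) / real R + 12 / (c - 1)))"
    by (simp only: integral_mult_right)
  have "integral ?I (window_bound D K H R k \<delta> c) \<le> real N * (2 + ?C) +
      real N * (520 / (c - 1) * (53/40) ^ k * (\<Sum>h = 1..<H. 1 / real h)) +
      real N * (32 * (2 * (real K + 2) / real R + 12 / (c - 1)))"
    unfolding split 1 by (intro add_mono order_refl 2 3)
  also have "\<dots> = real N * (2 + 520 / (c - 1) * (53/40) ^ k * (\<Sum>h = 1..<H. 1 / real h) + ?C +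
      32 * (2 * (real K + 2) / real R + 12 / (c - 1)))"
    by (simp only: distrib_left add.assoc add.commute add.left_commute)
  finally show ?thesis .
qed

section \<open>From windows to dyadic blocks\<close>

text \<open>Shifting the block by one changes its sum by at most 2, so the sum may be averaged over
  the shifts \<open>r = 1, ..., K\<close>; exchanging the summations turns the average into window
  sums.\<close>

lemma window_average_le:
  fixes t :: "nat \<Rightarrow> real"
  assumes t: "\<And>n. \<bar>t n\<bar> \<le> 1"
  shows "real K * \<bar>\<Sum>n = N + 1..2 * N. t n\<bar> \<le> (\<Sum>j = N..<2 * N. \<bar>\<Sum>r = 1..K. t (j + r)\<bar>) + 2 * (real K)\<^sup>2"
proof -
  define A where "A r = (\<Sum>j = N..<2 * N. t (j + r))" for r
  have step: "\<bar>A (Suc r) - A r\<bar> \<le> 2" for r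
  proof -
    have "A (Suc r) - A r = t (2 * N + r) - t (N + r)"
      unfolding A_def sum_subtractf[symmetric]
      using sum_Suc_diff'[of N "2 * N" "\<lambda>j. t (j + r)"] by simp
    then show ?thesis using t[of "2 * N + r"] t[of "N + r"] by simp
  qed
  have A1: "\<bar>A (Suc r) - A 1\<bar> \<le> 2 * real r" for r
  proof (induction r)
    case (Suc r)
    then show ?case using step[of "Suc r"] by simp
  qed simp
  have S: "(\<Sum>n = N + 1..2 * N. t n) = A 1"
    unfolding A_def by (rule sum.reindex_bij_witness[of _ "\<lambda>j. j + 1" "\<lambda>n. n - 1"]) auto
  have "real K * A 1 - (\<Sum>r = 1..K. A r) = (\<Sum>r = 1..K. A 1 - A r)"
    by (simp add: sum_subtractf)
  also have "\<bar>\<dots>\<bar> \<le> (\<Sum>r = 1..K. 2 * real K)"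
  proof (rule order_trans[OF sum_abs sum_mono])
    fix r assume "r \<in> {1..K}"
    then obtain s where "r = Suc s" "s < K" by (cases r) auto
    then show "\<bar>A 1 - A r\<bar> \<le> 2 * real K" using A1[of s] by simp
  qed
  finally have 1: "\<bar>real K * A 1 - (\<Sum>r = 1..K. A r)\<bar> \<le> 2 * (real K)\<^sup>2"
    by (simp add: power2_eq_square)
  have "(\<Sum>r = 1..K. A r) = (\<Sum>j = N..<2 * N. \<Sum>r = 1..K. t (j + r))"
    unfolding A_def by (rule sum.swap)
  then have "\<bar>\<Sum>r = 1..K. A r\<bar> \<le> (\<Sum>j = N..<2 * N. \<bar>\<Sum>r = 1..K. t (j + r)\<bar>)" by simp
  moreover have "real K * \<bar>A 1\<bar> = \<bar>real K * A 1\<bar>" by (simp add: abs_mult)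
  ultimately show ?thesis using 1 unfolding S by linarith
qed

text \<open>A bound valid for every point of tangency in \<open>[j, j + 1]\<close> is at most the
  mean of \<open>G\<close> over that interval; the intervals join to form the whole range.\<close>

lemma sum_le_integral_blocks:
  fixes G :: "real \<Rightarrow> real" and b :: "nat \<Rightarrow> real"
  assumes G: "continuous_on {real m..real n} G" and "m \<le> n"
    and b: "\<And>j x. m \<le> j \<Longrightarrow> j < n \<Longrightarrow> real j \<le> x \<Longrightarrow> x \<le> real j + 1 \<Longrightarrow> b j \<le> G x"
  shows "(\<Sum>j = m..<n. b j) \<le> integral {real m..real n} G"
  using assms(2,1,3)
proof (induction n rule: dec_induct)
  case base
  then show ?case by simp
next
  case (step n)
  have c1: "continuous_on {real m..real n} G" and c2: "continuous_on {real n..real (Suc n)} G"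
    using step.hyps by (auto intro: continuous_on_subset[OF step.prems(1)])
  have "(\<Sum>j = m..<n. b j) \<le> integral {real m..real n} G"
    using step.prems c1 by (intro step.IH) auto
  moreover have "b n \<le> integral {real n..real (Suc n)} G"
  proof -
    have "integral {real n..real (Suc n)} (\<lambda>_. b n) \<le> integral {real n..real (Suc n)} G"
      using step.prems(2)[of n] step.hyps by (intro integral_le integrable_continuous_real c2) auto
    then show ?thesis by simp
  qed
  moreover have "integral {real m..real n} G + integral {real n..real (Suc n)} G = integral {real m..real (Suc n)} G"
    using step.hyps
    by (intro Henstock_Kurzweil_Integration.integral_combine integrable_continuous_real step.prems) auto
  ultimately show ?case using step.hyps by simp
qed

lemma continuous_on_window_bound:
  assumes "0 < A"
  shows "continuous_on {A..B} (window_bound D K H R k \<delta> c)"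
proof -
  note cp = continuous_on_powr_const[OF assms]
  show ?thesis unfolding window_bound_def[abs_def]
    by (intro continuous_on_add continuous_on_mult continuous_on_sum continuous_on_const
        continuous_on_tm_major continuous_on_fejer cp)
qed

text \<open>The difference \<open>harm n - ln n\<close> is decreasing and equals 1 at
  \<open>n = 1\<close>.\<close>

lemma sum_inverse_le_ln:
  assumes "1 \<le> H"
  shows "(\<Sum>h = 1..<H. 1 / real h) \<le> 1 + ln (real H)"
proof -
  have "(\<Sum>h = 1..<H. 1 / real h) \<le> (\<Sum>h = 1..H. 1 / real h)"
    by (intro sum_mono2) auto
  also have "\<dots> = harm H" by (simp add: harm_def field_simps)
  also have "\<dots> \<le> 1 + ln (real H)"
    using euler_mascheroni_sequence_decreasing[of 1 H] assms by (simp add: harm_expand)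
  finally show ?thesis .
qed

text \<open>Numerically \<open>(53/40)^27 \<le> 2^11\<close>, so the growth rate 53/40 per doubling
  is at most \<open>2 powr (11/27)\<close>.\<close>

lemma power_53_40_le:
  assumes "2 ^ k \<le> X"
  shows "(53/40 :: real) ^ k \<le> X powr (11/27)"
proof -
  have "(53/40 :: real) ^ 27 \<le> 2 ^ 11" by (simp add: power_divide)
  also have "(2 :: real) ^ 11 = (2 powr (11/27)) ^ 27"
    by (simp add: powr_power)
  finally have "(53/40 :: real) \<le> 2 powr (11/27)"
    by (rule power_le_imp_le_base[where n = 26, simplified]) simp
  then have "(53/40 :: real) ^ k \<le> (2 powr (11/27)) ^ k" by (intro power_mono) auto
  also have "\<dots> = (2 ^ k) powr (11/27)" by (simp add: powr_power powr_powr mult.commute flip: powr_realpow)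
  also have "\<dots> \<le> X powr (11/27)" using assms by (intro powr_mono2) auto
  finally show ?thesis .
qed

lemma tm_dyadic_block_le:
  fixes c :: real and N K :: nat
  assumes c: "1 < c" "c < 2" and N: "1 \<le> N" and K: "1 \<le> K" "K \<le> N"
    and small: "2 * (real K)\<^sup>2 * real N powr (c - 2) \<le> 1 / 6"
  shows "\<bar>\<Sum>n = N + 1..2 * N. tm (nat \<lfloor>real n powr c\<rfloor>)\<bar> \<le>
    5200 / (c - 1) * (real N * (real N powr (c - 1)) powr (11/27) * real K powr (11/27 - 1) * (2 + 4 * ln (real N)) +
      (real K)\<^sup>2 * real N powr (c - 1) + real K)"
proof -
  define D where "D = real N powr (c - 1)"
  define \<delta> where "\<delta> = 2 * (real K)\<^sup>2 * real N powr (c - 2)"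
  \<comment> \<open>A power of \<open>N\<close> large enough to make the smoothing error bounded;
    the length of the sum over \<open>h\<close> enters only through its logarithm.\<close>
  define H where "H = N ^ 4"
  \<comment> \<open>The largest integer with \<open>6 * R * \<delta> \<le> 1\<close>, so that
    \<open>1 / R\<close> is of order \<open>\<delta>\<close> and the count of exceptional points of
    order \<open>K * \<delta>\<close>.\<close>
  define R where "R = nat \<lfloor>1 / (6 * \<delta>)\<rfloor>"
  have N0: "0 < real N" and K0: "0 < real K" using N K by auto
  have D: "1 \<le> D" unfolding D_def using N c by (intro ge_one_powr_ge_zero) auto
  have DN: "D \<le> real N" using powr_mono[of "c - 1" 1 "real N"] N c by (simp add: D_def)
  have \<delta>: "0 < \<delta>" "\<delta> \<le> 1 / 6" using small N0 K0 by (auto simp: \<delta>_def)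
  have inv: "1 \<le> 1 / (6 * \<delta>)" using \<delta> by (simp add: field_simps)
  then have "0 \<le> 1 / (6 * \<delta>)" by linarith
  from real_nat_floor[OF this] have Rf: "real R \<le> 1 / (6 * \<delta>)" "1 / (6 * \<delta>) < real R + 1"
    unfolding R_def by blast+
  then have R1: "1 \<le> R" using inv by linarith
  have R6: "6 * real R * \<delta> \<le> 1" using Rf(1) \<delta> by (simp add: field_simps)
  have "1 / (6 * \<delta>) < 2 * real R" using Rf R1 inv by linarith
  then have R12: "1 / real R \<le> 12 * \<delta>" using \<delta> R1 by (simp add: field_simps)
  have "1 * 1 \<le> D * real K" using D K by (intro mult_mono) auto
  then have DK: "1 \<le> D * real K" by simp
  \<comment> \<open>The least admissible \<open>k\<close>: minimality gives
    \<open>2 ^ k < 2 * (4 * D * K + 1)\<close>, which is at most \<open>10 * D * K\<close> because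
    \<open>D * K \<ge> 1\<close>.\<close>
  obtain k where k: "4 * D * real K + 1 \<le> 2 ^ k" "2 ^ k \<le> 10 * (D * real K)"
  proof -
    have ex: "\<exists>k. 4 * D * real K + 1 \<le> 2 ^ k"
      using real_arch_pow[of 2 "4 * D * real K + 1"] by (auto intro: less_imp_le)
    define k where "k = (LEAST k. 4 * D * real K + 1 \<le> 2 ^ k)"
    have k1: "4 * D * real K + 1 \<le> 2 ^ k" unfolding k_def using ex by (rule LeastI_ex)
    have "k \<noteq> 0" using k1 DK by (intro notI) (simp add: mult.assoc)
    then obtain k' where k': "k = Suc k'" by (cases k) auto
    then have "\<not> 4 * D * real K + 1 \<le> 2 ^ k'" unfolding k_def by (intro not_less_Least) simp
    then have "2 ^ k \<le> 2 * (4 * D * real K + 1)" by (simp add: k')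
    also have "\<dots> \<le> 10 * (D * real K)" using DK by (simp add: mult.assoc)
    finally show ?thesis using that k1 by blast
  qed
  define L where "L = (53/40 :: real) ^ k"
  define P where "P = (D * real K) powr (11/27)"
  have P: "1 \<le> P" unfolding P_def using DK by (intro ge_one_powr_ge_zero) auto
  have "L \<le> (10 * (D * real K)) powr (11/27)" unfolding L_def using k(2) by (rule power_53_40_le)
  also have "\<dots> = 10 powr (11/27) * P" using DK by (simp add: P_def powr_mult)
  also have "\<dots> \<le> 10 powr 1 * P" using P by (intro mult_right_mono powr_mono) auto
  finally have L: "L \<le> 10 * P" by simp
  have H: "0 < H" using N by (simp add: H_def)
  have lnH: "(\<Sum>h = 1..<H. 1 / real h) \<le> 1 + 4 * ln (real N)"
    using sum_inverse_le_ln[of H] H N0 by (simp add: H_def ln_realpow)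
  have ln0: "0 \<le> ln (real N)" using N by simp
  have C1: "(4 * D * real K + 2) * (4 * D)\<^sup>2 / (real H * \<delta>\<^sup>2) \<le> 24"
  proof -
    \<comment> \<open>The identity \<open>2 * K^2 * D = N * \<delta>\<close> keeps
      \<open>\<delta>\<close> from being small: \<open>4 * D \<le> 2 * N * \<delta>\<close>. With
      \<open>D * K \<le> N^2\<close>, the numerator is then at most
      \<open>24 * N^4 * \<delta>^2\<close>.\<close>
    have "real N powr (c - 1) = real N * real N powr (c - 2)"
      using powr_add[of "real N" 1 "c - 2"] N0 by simp
    then have "2 * (real K)\<^sup>2 * D = real N * \<delta>" by (simp add: D_def \<delta>_def)
    moreover have "2 * 1 * D \<le> 2 * (real K)\<^sup>2 * D" using D K by (intro mult_mono) (auto simp: one_le_power)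
    ultimately have "4 * D \<le> 2 * (real N * \<delta>)" by linarith
    then have "(4 * D)\<^sup>2 \<le> (2 * (real N * \<delta>))\<^sup>2" using D by (intro power_mono) auto
    moreover have "4 * D * real K + 2 \<le> 6 * (real N)\<^sup>2"
    proof -
      have "D * real K \<le> real N * real N" using D DN K by (intro mult_mono) auto
      moreover have "1 \<le> (real N)\<^sup>2" using N by (intro one_le_power) auto
      ultimately show ?thesis unfolding power2_eq_square by linarith
    qed
    ultimately have "(4 * D * real K + 2) * (4 * D)\<^sup>2 \<le> 6 * (real N)\<^sup>2 * (2 * (real N * \<delta>))\<^sup>2"
      using D by (intro mult_mono) auto
    also have "\<dots> = 24 * (real H * \<delta>\<^sup>2)" by (simp add: H_def power_mult_distrib power4_eq_xxxx power2_eq_square)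
    finally show ?thesis using H \<delta> by (simp add: divide_le_eq)
  qed
  have R3: "2 * (real K + 2) / real R \<le> 72 * (real K * \<delta>)"
  proof -
    have "2 * (real K + 2) * (1 / real R) \<le> 2 * (3 * real K) * (12 * \<delta>)"
      using K R12 by (intro mult_mono) auto
    then show ?thesis by simp
  qed
  let ?b = "\<lambda>j. \<bar>\<Sum>r = 1..K. tm (nat \<lfloor>real (j + r) powr c\<rfloor>)\<bar>"
  have "(\<Sum>j = N..<2 * N. ?b j) \<le> integral {real N..real (2 * N)} (window_bound D K H R k \<delta> c)"
  proof (rule sum_le_integral_blocks)
    fix j x assume "N \<le> j" "j < 2 * N" "real j \<le> x" "x \<le> real j + 1"
    then show "?b j \<le> window_bound D K H R k \<delta> c x"
      unfolding D_def \<delta>_def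
      by (intro tm_window_le c N K H) (use R1 R6 k in \<open>auto simp: D_def \<delta>_def\<close>)
  qed (auto intro: continuous_on_window_bound[OF N0])
  also have "\<dots> \<le> real N * (2 + 520 / (c - 1) * L * (\<Sum>h = 1..<H. 1 / real h) +
      2 * ((4 * D * real K + 2) * (4 * D)\<^sup>2 / (real H * \<delta>\<^sup>2)) +
      32 * (2 * (real K + 2) / real R + 12 / (c - 1)))"
    using integral_window_bound_le[OF c N, of R K H k \<delta>] R1 unfolding D_def L_def by simp
  also have "\<dots> \<le> real N * (2 + 520 / (c - 1) * (10 * P) * (1 + 4 * ln (real N)) +
      2 * 24 + 32 * (72 * (real K * \<delta>) + 12 / (c - 1)))"
    using c L lnH C1 R3 P ln0
    by (intro mult_left_mono add_mono mult_mono order_refl) (auto intro!: sum_nonneg)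
  finally have sumb: "(\<Sum>j = N..<2 * N. ?b j) \<le> real N * (2 + 520 / (c - 1) * (10 * P) * (1 + 4 * ln (real N)) +
      2 * 24 + 32 * (72 * (real K * \<delta>) + 12 / (c - 1)))" .
  \<comment> \<open>As 5200 = 520 * 10, this is the coefficient of the exponential sum term; because
    \<open>c - 1 < 1\<close> and \<open>P \<ge> 1\<close>, it also dominates the remaining
    constants.\<close>
  define M where "M = 5200 / (c - 1)"
  have M: "5200 \<le> M" using c by (simp add: M_def field_simps)
  have "2 + 520 / (c - 1) * (10 * P) * (1 + 4 * ln (real N)) + 2 * 24 + 32 * (72 * (real K * \<delta>) + 12 / (c - 1))
     \<le> M * P * (2 + 4 * ln (real N)) + M / 2 * (real K * \<delta>)"
  proof -
    have "520 / (c - 1) * (10 * P) * (1 + 4 * ln (real N)) = M * P * (1 + 4 * ln (real N))"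
      by (simp add: M_def)
    moreover have "2 + 2 * 24 + 32 * (12 / (c - 1)) \<le> M * P"
    proof -
      have "32 * (12 / (c - 1)) = 384 / 5200 * M" by (simp add: M_def)
      then have "2 + 2 * 24 + 32 * (12 / (c - 1)) \<le> M * 1" using M by simp
      also have "\<dots> \<le> M * P" using M P by (intro mult_left_mono) auto
      finally show ?thesis .
    qed
    moreover have "32 * 72 * (real K * \<delta>) \<le> M / 2 * (real K * \<delta>)"
      using M \<delta> by (intro mult_right_mono) auto
    ultimately show ?thesis by (simp add: algebra_simps)
  qed
  then have "real N * (2 + 520 / (c - 1) * (10 * P) * (1 + 4 * ln (real N)) + 2 * 24 + 32 * (72 * (real K * \<delta>) + 12 / (c - 1)))
     \<le> real N * (M * P * (2 + 4 * ln (real N)) + M / 2 * (real K * \<delta>))"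
    by (intro mult_left_mono) auto
  with sumb have "(\<Sum>j = N..<2 * N. ?b j) \<le> real N * (M * P * (2 + 4 * ln (real N)) + M / 2 * (real K * \<delta>))"
    by linarith
  moreover have "real K * \<bar>\<Sum>n = N + 1..2 * N. tm (nat \<lfloor>real n powr c\<rfloor>)\<bar> \<le> (\<Sum>j = N..<2 * N. ?b j) + 2 * (real K)\<^sup>2"
    by (rule window_average_le) simp
  moreover have "2 * (real K)\<^sup>2 \<le> M * (real K)\<^sup>2" using M by (intro mult_right_mono) auto
  ultimately have "real K * \<bar>\<Sum>n = N + 1..2 * N. tm (nat \<lfloor>real n powr c\<rfloor>)\<bar> \<le>
      real N * (M * P * (2 + 4 * ln (real N)) + M / 2 * (real K * \<delta>)) + M * (real K)\<^sup>2" by linarith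
  also have "\<dots> = real K * (M * (real N * D powr (11/27) * real K powr (11/27 - 1) * (2 + 4 * ln (real N)) +
      (real K)\<^sup>2 * D + real K))"
  proof -
    have "P = real K * (D powr (11/27) * real K powr (11/27 - 1))"
      using D K0 powr_add[of "real K" 1 "11/27 - 1"] by (simp add: P_def powr_mult)
    moreover have "real N * \<delta> = 2 * (real K)\<^sup>2 * D"
      using powr_add[of "real N" 1 "c - 2"] N0 by (simp add: D_def \<delta>_def)
    then have "real N * (M / 2 * (real K * \<delta>)) = M * real K * ((real K)\<^sup>2 * D)"
      by (simp add: algebra_simps)
    ultimately show ?thesis by (simp add: algebra_simps power2_eq_square)
  qed
  finally show ?thesis unfolding M_def D_def by (rule mult_left_le_imp_le) (rule K0)
qed

text \<open>The bound \<open>(27 - 19 * c) / 35\<close> is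
  \<open>(2 - (a + 1) * c) / (3 - a)\<close> at \<open>a = 11/27\<close>. At this exponent the
  estimate holds with an additional logarithm, which any smaller \<open>\<eta>\<close> absorbs
  through \<open>ln N \<le> N powr \<epsilon> / \<epsilon>\<close>.\<close>

lemma tm_dyadic_block_powr_le:
  fixes c \<eta> :: real
  assumes c: "1 < c" "c < 2" and \<eta>: "0 < \<eta>" "\<eta> < (27 - 19 * c) / 35"
  shows "\<exists>C\<ge>0. \<forall>N\<ge>1. \<bar>\<Sum>n = N + 1..2 * N. tm (nat \<lfloor>real n powr c\<rfloor>)\<bar> \<le> C * real N powr (1 - \<eta>)"
proof -
  define \<eta>0 where "\<eta>0 = (27 - 19 * c) / 35"
  text \<open>The window length \<open>N powr \<kappa>\<close> balances the error of the linear approximation against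
    the exponential sum.\<close>
  define \<kappa> where "\<kappa> = (43 - 16 * c) / 70"
  define M where "M = 5200 / (c - 1)"
  define \<epsilon> where "\<epsilon> = \<eta>0 - \<eta>"
  have \<epsilon>: "0 < \<epsilon>" using \<eta> by (simp add: \<epsilon>_def \<eta>0_def)
  have \<kappa>: "0 < \<kappa>" "\<kappa> < 1" using c by (auto simp: \<kappa>_def)
  have e1: "1 + (c - 1) * (11/27) + \<kappa> * (11/27 - 1) = 1 - \<eta>0"
    and e2: "2 * \<kappa> + (c - 1) = 1 - \<eta>0" and e3: "\<kappa> \<le> 1 - \<eta>0"
    using c by (auto simp: \<kappa>_def \<eta>0_def field_simps)
  have M: "0 \<le> M" using c by (simp add: M_def)
  define C where "C = 48 + M * (8 + 4 / \<epsilon>)"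
  have "C \<ge> 0" unfolding C_def using M \<epsilon> by simp
  moreover have "\<bar>\<Sum>n = N + 1..2 * N. tm (nat \<lfloor>real n powr c\<rfloor>)\<bar> \<le> C * real N powr (1 - \<eta>)" if N: "1 \<le> N" for N
  proof -
    let ?S = "\<bar>\<Sum>n = N + 1..2 * N. tm (nat \<lfloor>real n powr c\<rfloor>)\<bar>"
    have N1: "1 \<le> real N" using N by simp
    have mono: "real N powr (1 - \<eta>0) \<le> real N powr (1 - \<eta>)"
      using N1 \<eta> by (intro powr_mono) (auto simp: \<eta>0_def)
    show ?thesis
    \<comment> \<open>For such \<open>N\<close> the trivial bound suffices. Otherwise rounding up
      gives \<open>K^2 \<le> 4 * N powr (2 * \<kappa>)\<close>, so twice
      \<open>K^2 * N powr (c - 2)\<close> is at most \<open>8 * N powr (- \<eta>0)\<close>; this is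
      below 1/6 exactly when \<open>N powr \<eta>0\<close> exceeds 48 = 8 * 6.\<close>
    proof (cases "real N powr \<eta>0 \<le> 48")
      case True
      have "?S \<le> (\<Sum>n = N + 1..2 * N. 1)" by (rule order_trans[OF sum_abs]) simp
      also have "\<dots> = real N" by simp
      also have "real N = real N powr \<eta>0 * real N powr (1 - \<eta>0)"
        using N1 by (simp flip: powr_add)
      also have "\<dots> \<le> 48 * real N powr (1 - \<eta>)" using True mono by (intro mult_mono) auto
      also have "\<dots> \<le> C * real N powr (1 - \<eta>)"
        using M \<epsilon> by (intro mult_right_mono) (auto simp: C_def)
      finally show ?thesis .
    next
      case False
      define K where "K = nat \<lceil>real N powr \<kappa>\<rceil>"
      have Nk: "1 \<le> real N powr \<kappa>" using N1 \<kappa> by (intro ge_one_powr_ge_zero) auto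
      have Kr: "real K = of_int \<lceil>real N powr \<kappa>\<rceil>" using Nk by (simp add: K_def)
      have K: "real N powr \<kappa> \<le> real K" "real K \<le> 2 * real N powr \<kappa>"
        unfolding Kr using Nk by linarith+
      have K1: "1 \<le> K" using K(1) Nk by linarith
      have "real N powr \<kappa> \<le> real N powr 1" using N1 \<kappa> by (intro powr_mono) auto
      then have "\<lceil>real N powr \<kappa>\<rceil> \<le> int N" using N1 by (simp add: ceiling_le_iff)
      then have KN: "K \<le> N" unfolding K_def by linarith
      have "(real K)\<^sup>2 \<le> (2 * real N powr \<kappa>)\<^sup>2" using K by (intro power_mono) auto
      also have "\<dots> = 4 * real N powr (2 * \<kappa>)"
        by (simp add: power_mult_distrib power2_eq_square flip: powr_add)
      finally have K2: "(real K)\<^sup>2 \<le> 4 * real N powr (2 * \<kappa>)" .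
      have "2 * (real K)\<^sup>2 * real N powr (c - 2) \<le> 2 * (4 * real N powr (2 * \<kappa>)) * real N powr (c - 2)"
        using K2 by (intro mult_mono) auto
      also have "\<dots> = 8 * real N powr (2 * \<kappa> + (c - 2))" by (simp add: powr_add)
      also have "2 * \<kappa> + (c - 2) = - \<eta>0" using e2 by linarith
      also have "8 * real N powr (- \<eta>0) \<le> 1 / 6"
        using False N1 by (simp add: powr_minus_divide field_simps)
      finally have "2 * (real K)\<^sup>2 * real N powr (c - 2) \<le> 1 / 6" .
      from tm_dyadic_block_le[OF c N K1 KN this]
      have S: "?S \<le> M * (real N * (real N powr (c - 1)) powr (11/27) * real K powr (11/27 - 1) * (2 + 4 * ln (real N)) +
          (real K)\<^sup>2 * real N powr (c - 1) + real K)"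
        unfolding M_def .
      have b1: "real N * (real N powr (c - 1)) powr (11/27) * real K powr (11/27 - 1) \<le> real N powr (1 - \<eta>0)"
      proof -
        have "real K powr (11/27 - 1) \<le> (real N powr \<kappa>) powr (11/27 - 1)"
          using K Nk N1 by (intro powr_mono2') auto
        then have "real N * (real N powr (c - 1)) powr (11/27) * real K powr (11/27 - 1) \<le>
            real N powr 1 * (real N powr (c - 1)) powr (11/27) * (real N powr \<kappa>) powr (11/27 - 1)"
          using N1 by (intro mult_mono) auto
        also have "\<dots> = real N powr (1 + (c - 1) * (11/27) + \<kappa> * (11/27 - 1))"
          unfolding powr_powr powr_add ..
        finally show ?thesis unfolding e1 .
      qed
      have b2: "(real K)\<^sup>2 * real N powr (c - 1) \<le> 4 * real N powr (1 - \<eta>0)"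
      proof -
        have "(real K)\<^sup>2 * real N powr (c - 1) \<le> 4 * real N powr (2 * \<kappa>) * real N powr (c - 1)"
          using K2 by (intro mult_right_mono) auto
        also have "\<dots> = 4 * real N powr (2 * \<kappa> + (c - 1))" by (simp add: powr_add)
        finally show ?thesis unfolding e2 .
      qed
      have b3: "real K \<le> 2 * real N powr (1 - \<eta>0)"
        using K(2) powr_mono[OF e3 N1] by linarith
      have ln: "0 \<le> ln (real N)" "ln (real N) \<le> real N powr \<epsilon> / \<epsilon>"
        using N1 \<epsilon> by (auto intro: ln_powr_bound)
      have "?S \<le> M * (real N powr (1 - \<eta>0) * (2 + 4 * ln (real N)) + 4 * real N powr (1 - \<eta>0) + 2 * real N powr (1 - \<eta>0))"
        by (rule order_trans[OF S]) (intro mult_left_mono add_mono mult_right_mono b1 b2 b3 M, use ln in auto)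
      also have "\<dots> = M * (8 * real N powr (1 - \<eta>0) + 4 * (real N powr (1 - \<eta>0) * ln (real N)))"
        by (simp add: algebra_simps)
      also have "\<dots> \<le> M * (8 * real N powr (1 - \<eta>) + 4 * (real N powr (1 - \<eta>) / \<epsilon>))"
      proof (intro mult_left_mono add_mono mono M)
        have "real N powr (1 - \<eta>0) * ln (real N) \<le> real N powr (1 - \<eta>0) * (real N powr \<epsilon> / \<epsilon>)"
          using ln by (intro mult_left_mono) auto
        also have "\<dots> = real N powr (1 - \<eta>0 + \<epsilon>) / \<epsilon>" by (simp add: powr_add)
        also have "1 - \<eta>0 + \<epsilon> = 1 - \<eta>" by (simp add: \<epsilon>_def)
        finally show "real N powr (1 - \<eta>0) * ln (real N) \<le> real N powr (1 - \<eta>) / \<epsilon>" .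
      qed auto
      also have "\<dots> = M * (8 + 4 / \<epsilon>) * real N powr (1 - \<eta>)" by (simp add: algebra_simps)
      also have "\<dots> \<le> C * real N powr (1 - \<eta>)" by (intro mult_right_mono) (auto simp: C_def)
      finally show ?thesis .
    qed
  qed
  ultimately show ?thesis by blast
qed

section \<open>From dyadic blocks to the full sum\<close>

text \<open>Strong induction with \<open>m = N div 2\<close>: the sum up to \<open>N\<close>
  consists of the sum up to \<open>m\<close>, one dyadic block and at most one further term when
  \<open>N\<close> is odd. Halving gains the factor \<open>q < 1\<close>, so the constant does not
  grow.\<close>

lemma dyadic_blocks_bound:
  fixes t :: "nat \<Rightarrow> real"
  assumes t: "\<And>n. \<bar>t n\<bar> \<le> 1" and \<beta>: "0 < \<beta>" and C: "0 \<le> C"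
    and block: "\<And>N. 1 \<le> N \<Longrightarrow> \<bar>\<Sum>n = N + 1..2 * N. t n\<bar> \<le> C * real N powr \<beta>"
  shows "\<exists>A. \<forall>N\<ge>1. \<bar>\<Sum>n = 1..N. t n\<bar> \<le> A * real N powr \<beta>"
proof -
  define q where "q = 2 powr (- \<beta>)"
  have q: "0 < q" "q < 1"
  proof -
    show "0 < q" by (simp add: q_def)
    have "2 powr (- \<beta>) < 2 powr (0 :: real)" using \<beta> by (intro powr_less_mono) auto
    then show "q < 1" by (simp add: q_def)
  qed
  \<comment> \<open>The fixed point of \<open>A = q * A + C + 1\<close>, where \<open>q * A\<close>
    comes from the induction hypothesis, \<open>C\<close> from the block and 1 from the leftover
    term.\<close>
  define A where "A = (C + 1) / (1 - q)"
  have A: "0 \<le> A" "A = q * A + C + 1" using q C by (auto simp: A_def field_simps)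
  have "\<bar>\<Sum>n = 1..N. t n\<bar> \<le> A * real N powr \<beta>" for N
  proof (induction N rule: less_induct)
    case (less N)
    consider "N = 0" | "N = 1" | "N \<ge> 2" by linarith
    then show ?case
    proof cases
      case 2
      have "1 \<le> A" using A q C by (smt (verit) mult_nonneg_nonneg)
      then show ?thesis using 2 t[of 1] by simp
    next
      case 3
      define m where "m = N div 2"
      have m: "1 \<le> m" "m < N" "2 * m \<le> N" "N \<le> 2 * m + 1" using 3 by (auto simp: m_def)
      have mq: "real m powr \<beta> \<le> q * real N powr \<beta>"
      proof -
        have "real m powr \<beta> \<le> (real N / 2) powr \<beta>" using m \<beta> by (intro powr_mono2) auto
        also have "\<dots> = q * real N powr \<beta>" by (simp add: powr_divide q_def powr_minus_divide)
        finally show ?thesis .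
      qed
      have "sum t {1..N} = sum t {1..m} + sum t {m + 1..2 * m} + sum t {2 * m + 1..N}"
        using m sum.ub_add_nat[of 1 m t m] sum.ub_add_nat[of 1 "2 * m" t "N - 2 * m"]
        by (simp add: mult_2)
      moreover have "\<bar>sum t {1..m}\<bar> \<le> A * real m powr \<beta>" using less[OF m(2)] .
      moreover have "\<bar>sum t {m + 1..2 * m}\<bar> \<le> C * real m powr \<beta>" using block[OF m(1)] .
      moreover have "\<bar>sum t {2 * m + 1..N}\<bar> \<le> 1"
      proof -
        have "\<bar>sum t {2 * m + 1..N}\<bar> \<le> (\<Sum>n = 2 * m + 1..N. 1)"
          by (rule order_trans[OF sum_abs sum_mono]) (rule t)
        then show ?thesis using m by simp
      qed
      ultimately have "\<bar>sum t {1..N}\<bar> \<le> A * real m powr \<beta> + C * real m powr \<beta> + 1" by linarith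
      also have "\<dots> \<le> A * (q * real N powr \<beta>) + C * (1 * real N powr \<beta>) + 1 * real N powr \<beta>"
      proof (intro add_mono mult_left_mono mq A C)
        show "real m powr \<beta> \<le> 1 * real N powr \<beta>" using m \<beta> by (simp add: powr_mono2)
        show "1 \<le> 1 * real N powr \<beta>" using m \<beta> by (simp add: ge_one_powr_ge_zero)
      qed
      also have "\<dots> = (q * A + C + 1) * real N powr \<beta>" by (simp add: algebra_simps)
      finally show ?thesis unfolding A(2)[symmetric] .
    qed (use A in auto)
  qed
  then show ?thesis by blast
qed

lemma tm_ps_sum_bound:
  fixes c \<eta> :: real
  assumes c: "1 < c" "c < 2" and \<eta>: "0 < \<eta>" "\<eta> < (27 - 19 * c) / 35"
  shows "\<exists>C. \<forall>N\<ge>2. \<bar>tm_ps_sum c N\<bar> / real N \<le> C * real N powr (- \<eta>)"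
proof -
  obtain C0 where "0 \<le> C0" and
    C0: "\<And>N. 1 \<le> N \<Longrightarrow> \<bar>\<Sum>n = N + 1..2 * N. tm (nat \<lfloor>real n powr c\<rfloor>)\<bar> \<le> C0 * real N powr (1 - \<eta>)"
    using tm_dyadic_block_powr_le[OF assms] by blast
  moreover have "0 < 1 - \<eta>" using c \<eta> by simp
  ultimately obtain C where C: "\<bar>\<Sum>n = 1..N. tm (nat \<lfloor>real n powr c\<rfloor>)\<bar> \<le> C * real N powr (1 - \<eta>)" if "1 \<le> N" for N
    using dyadic_blocks_bound[of "\<lambda>n. tm (nat \<lfloor>real n powr c\<rfloor>)" "1 - \<eta>" C0] by auto
  have "\<bar>tm_ps_sum c N\<bar> / real N \<le> C * real N powr (- \<eta>)" if "2 \<le> N" for N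
  proof -
    have "\<bar>tm_ps_sum c N\<bar> / real N \<le> C * real N powr (1 - \<eta>) / real N"
      using C[of N] that by (intro divide_right_mono) (auto simp: tm_ps_sum_def tm_def)
    also have "\<dots> = C * real N powr (- \<eta>)"
      using that powr_add[of "real N" 1 "- \<eta>"] by simp
    finally show ?thesis .
  qed
  then show ?thesis by blast
qed

theorem theorem2:
  shows "(\<exists>a::real. 0 \<le> a \<and> a < 0.4076 \<and>
           (\<forall>c::real. 1 < c \<and> c < 2 \<longrightarrow>
             (\<forall>\<eta>::real. 0 < \<eta> \<and> \<eta> < (2 - (a + 1) * c) / (3 - a) \<longrightarrow>
               (\<exists>C::real. \<forall>N::nat. N \<ge> 2 \<longrightarrow>
                  \<bar>tm_ps_sum c N\<bar> / real N \<le> C * real N powr (-\<eta>)))))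
       \<and> (\<forall>c::real. 1 < c \<and> c \<le> 1.42 \<longrightarrow>
           (\<exists>\<eta>::real. \<eta> > max 0 ((7 - 5 * c) / 9) \<and>
             (\<exists>C::real. \<forall>N::nat. N \<ge> 2 \<longrightarrow>
                \<bar>tm_ps_sum c N\<bar> / real N \<le> C * real N powr (-\<eta>))))"
proof (rule conjI, goal_cases)
  case 1
  show ?case
  \<comment> \<open>11/27 = 0.40740... is the exponent provided by the growth rate 53/40.\<close>
  proof (rule exI[of _ "11/27"], intro conjI allI impI)
    fix c \<eta> :: real
    assume "1 < c \<and> c < 2" and \<eta>: "0 < \<eta> \<and> \<eta> < (2 - (11/27 + 1) * c) / (3 - 11/27)"
    moreover have "(2 - (11/27 + 1) * c) / (3 - 11/27) = (27 - 19 * c) / 35" by simp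
    ultimately show "\<exists>C. \<forall>N\<ge>2. \<bar>tm_ps_sum c N\<bar> / real N \<le> C * real N powr (- \<eta>)"
      by (intro tm_ps_sum_bound) auto
  qed auto
next
  case 2
  show ?case
  proof (intro allI impI)
    fix c :: real
    assume c: "1 < c \<and> c \<le> 1.42"
    \<comment> \<open>Positivity holds up to \<open>c = 1.42\<close> because 19 * 1.42 = 26.98 < 27;
      the comparison with \<open>(7 - 5 * c) / 9\<close> amounts to \<open>c > 1 / 2\<close>. Any
      \<open>\<eta>\<close> strictly in between then works.\<close>
    then have "max 0 ((7 - 5 * c) / 9) < (27 - 19 * c) / 35" unfolding max_less_iff_conj by auto
    then obtain \<eta> where \<eta>: "max 0 ((7 - 5 * c) / 9) < \<eta>" "\<eta> < (27 - 19 * c) / 35" using dense by blast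
    then have "\<exists>C. \<forall>N\<ge>2. \<bar>tm_ps_sum c N\<bar> / real N \<le> C * real N powr (- \<eta>)"
      using c by (intro tm_ps_sum_bound) auto
    with \<eta> show "\<exists>\<eta>::real. \<eta> > max 0 ((7 - 5 * c) / 9) \<and>
        (\<exists>C::real. \<forall>N::nat. N \<ge> 2 \<longrightarrow> \<bar>tm_ps_sum c N\<bar> / real N \<le> C * real N powr (-\<eta>))" by blast
  qed
qed

end
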